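(* Let $A$ be an $R$-algebra that is $p$-torsion free, $p$-adically complete, with $A/pA$ reduced, equipped with a Frobenius lift $\phi$; let $\mathcal A=A\otimes_R\mathbb K^\circ$ with its endomorphism $\Phi$ (compatible with $\phi$ and with the canonical relative Frobenius lift of $\mathbb K^\circ$), $\mathcal B'=\varinjlim_\Phi\mathcal A$ and $P^\circ(A,\phi)=\widehat{\mathcal B'}$ with induced endomorphism $\Phi$. Let $\iota:A\to P^\circ(A,\phi)$ be $\iota(a)=[a\otimes1,1]$. Let $C$ be a $p$-adically complete $\mathbb K^\circ$-algebra equipped with an invertible relative Frobenius lift $\Phi_C$. Then for every $R$-algebra homomorphism $u_1:A\to C$ with $u_1\circ\phi=\Phi_C\circ u_1$ there is a unique $\mathbb K^\circ$-algebra homomorphism $u:P^\circ(A,\phi)\to C$ such that $u\circ\iota=u_1$ and $\Phi_C\circ u=u\circ\Phi$.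
   Context: $p$ is an odd prime; $R$ is a complete discrete valuation ring with maximal ideal $pR$ and algebraically closed residue field; a Frobenius lift is a ring endomorphism reducing mod $p$ to $x\mapsto x^p$. $\widehat{\ }$ is $p$-adic completion. With fixed compatible roots $p^{1/p^m}$, $\mathbb K^\circ$ is the $p$-adic completion of $\bigcup_m R[p^{1/p^m}]$, $\mathbb K^{\circ\circ}$ its maximal ideal; the canonical relative Frobenius lift $\Phi$ of $\mathbb K^\circ$ is the unique ring automorphism extending the Frobenius lift of $R$ and fixing all $p^{1/p^m}$. A relative Frobenius lift on a $\mathbb K^\circ$-algebra $C$ is a ring endomorphism extending $\Phi$ on $\mathbb K^\circ$ and inducing the $p$-power Frobenius on $C/\mathbb K^{\circ\circ}C$; invertible means bijective. $\varinjlim_\Phi\mathcal A$ is the direct limit of $\mathcal A\xrightarrow{\Phi}\mathcal A\xrightarrow{\Phi}\cdots$, with elements $[a,i]$, $(a,i)\sim(\Phi(a),i+1)$. *)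

theory Defs
  imports "HOL-Algebra.Algebra"
begin

section \<open>Algebras, reduced rings, discrete valuation rings\<close>

text \<open>A ring \<open>B\<close>, regarded as an algebra along a homomorphism \<open>f\<close> into \<open>B\<close>.\<close>

definition algebra_via :: "('k \<Rightarrow> 'b) \<Rightarrow> ('b, 'm) ring_scheme \<Rightarrow> ('k, 'b) module"
  where "algebra_via f B =
    \<lparr>carrier = carrier B, monoid.mult = monoid.mult B, one = one B, ring.zero = ring.zero B, ring.add = ring.add B,
     smult = (\<lambda>k b. f k \<otimes>\<^bsub>B\<^esub> b)\<rparr>"

definition structure_map :: "('k, 'b, 'm) module_scheme \<Rightarrow> 'k \<Rightarrow> 'b"
  where "structure_map B k = k \<odot>\<^bsub>B\<^esub> \<one>\<^bsub>B\<^esub>"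

text \<open>A \<open>K\<close>-algebra \<open>C\<close> as an algebra over the base ring \<open>R\<close> of an \<open>R\<close>-algebra \<open>K\<close>.\<close>

definition restrict_scalars ::
    "('r, 'k, 'm) module_scheme \<Rightarrow> ('k, 'c, 'n) module_scheme \<Rightarrow> ('r, 'c) module"
  where "restrict_scalars K C = algebra_via (\<lambda>r. structure_map C (structure_map K r)) C"

definition algebra_hom ::
    "('k, 'l) ring_scheme \<Rightarrow> ('k, 'a, 'm) module_scheme \<Rightarrow> ('k, 'b, 'n) module_scheme \<Rightarrow> ('a \<Rightarrow> 'b) set"
  where "algebra_hom K A B =
    {h \<in> ring_hom A B. \<forall>k\<in>carrier K. \<forall>a\<in>carrier A. h (k \<odot>\<^bsub>A\<^esub> a) = k \<odot>\<^bsub>B\<^esub> h a}"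

definition reduced_ring :: "('a, 'm) ring_scheme \<Rightarrow> bool"
  where "reduced_ring R \<longleftrightarrow>
    (\<forall>x\<in>carrier R. \<forall>n::nat. x [^]\<^bsub>R\<^esub> n = \<zero>\<^bsub>R\<^esub> \<longrightarrow> x = \<zero>\<^bsub>R\<^esub>)"

definition discrete_valuation_ring :: "('a, 'm) ring_scheme \<Rightarrow> bool"
  where "discrete_valuation_ring R \<longleftrightarrow>
    principal_domain R \<and> (\<exists>!M. maximalideal M R) \<and> \<not> field R"

section \<open>The prime \<open>p\<close> in a ring, \<open>p\<close>-adic completion\<close>

definition p_power_ideal :: "nat \<Rightarrow> ('a, 'm) ring_scheme \<Rightarrow> nat \<Rightarrow> 'a set"
  where "p_power_ideal p R n = PIdl\<^bsub>R\<^esub> (([p] \<cdot>\<^bsub>R\<^esub> \<one>\<^bsub>R\<^esub>) [^]\<^bsub>R\<^esub> n)"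

abbreviation p_ideal :: "nat \<Rightarrow> ('a, 'm) ring_scheme \<Rightarrow> 'a set"
  where "p_ideal p R \<equiv> PIdl\<^bsub>R\<^esub> ([p] \<cdot>\<^bsub>R\<^esub> \<one>\<^bsub>R\<^esub>)"

definition p_torsion_free :: "nat \<Rightarrow> ('a, 'm) ring_scheme \<Rightarrow> bool"
  where "p_torsion_free p R \<longleftrightarrow>
    (\<forall>x\<in>carrier R. [p] \<cdot>\<^bsub>R\<^esub> x = \<zero>\<^bsub>R\<^esub> \<longrightarrow> x = \<zero>\<^bsub>R\<^esub>)"

text \<open>
  The inverse limit of the rings \<open>R/p\<^sup>nR\<close>. The transition map sends a coset of \<open>p\<^bsup>n+1\<^esup>R\<close> to the
  coset of \<open>p\<^sup>nR\<close> that contains it, so compatibility of a family of cosets is an inclusion.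
\<close>

definition padic_completion :: "nat \<Rightarrow> ('a, 'm) ring_scheme \<Rightarrow> (nat \<Rightarrow> 'a set) ring"
  where "padic_completion p R =
    \<lparr>carrier = {x. (\<forall>n. x n \<in> carrier (R Quot p_power_ideal p R n)) \<and> (\<forall>n. x (Suc n) \<subseteq> x n)},
     monoid.mult = (\<lambda>x y n. x n \<otimes>\<^bsub>R Quot p_power_ideal p R n\<^esub> y n),
     one = (\<lambda>n. \<one>\<^bsub>R Quot p_power_ideal p R n\<^esub>),
     ring.zero = (\<lambda>n. \<zero>\<^bsub>R Quot p_power_ideal p R n\<^esub>),
     ring.add = (\<lambda>x y n. x n \<oplus>\<^bsub>R Quot p_power_ideal p R n\<^esub> y n)\<rparr>"

definition to_completion :: "nat \<Rightarrow> ('a, 'm) ring_scheme \<Rightarrow> 'a \<Rightarrow> nat \<Rightarrow> 'a set"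
  where "to_completion p R a = (\<lambda>n. p_power_ideal p R n +>\<^bsub>R\<^esub> a)"

text \<open>The endomorphism of the completion induced by an endomorphism \<open>f\<close>.\<close>

definition completion_endo ::
    "nat \<Rightarrow> ('a, 'm) ring_scheme \<Rightarrow> ('a \<Rightarrow> 'a) \<Rightarrow> (nat \<Rightarrow> 'a set) \<Rightarrow> (nat \<Rightarrow> 'a set)"
  where "completion_endo p R f x = (\<lambda>n. \<Union>a\<in>x n. p_power_ideal p R n +>\<^bsub>R\<^esub> f a)"

text \<open>Completeness includes separatedness.\<close>

definition padically_complete :: "nat \<Rightarrow> ('a, 'm) ring_scheme \<Rightarrow> bool"
  where "padically_complete p R \<longleftrightarrow>
    bij_betw (to_completion p R) (carrier R) (carrier (padic_completion p R))"

definition frobenius_lift :: "nat \<Rightarrow> ('a, 'm) ring_scheme \<Rightarrow> ('a \<Rightarrow> 'a) \<Rightarrow> bool"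
  where "frobenius_lift p R f \<longleftrightarrow>
    f \<in> ring_hom R R \<and> (\<forall>x\<in>carrier R. f x \<ominus>\<^bsub>R\<^esub> x [^]\<^bsub>R\<^esub> p \<in> p_ideal p R)"

section \<open>The perfectoid base ring\<close>

text \<open>
  \<open>L\<close> is a field into which \<open>R\<close> is embedded by \<open>j\<close> (for instance an algebraic closure of the
  fraction field of \<open>R\<close>); \<open>\<pi> m\<close> is the chosen root \<open>p\<^bsup>1/p^m\<^esup>\<close> in \<open>L\<close>.
\<close>

definition compatible_p_roots :: "nat \<Rightarrow> ('l, 'm) ring_scheme \<Rightarrow> (nat \<Rightarrow> 'l) \<Rightarrow> bool"
  where "compatible_p_roots p L \<pi> \<longleftrightarrow>
    \<pi> 0 = [p] \<cdot>\<^bsub>L\<^esub> \<one>\<^bsub>L\<^esub> \<and> (\<forall>m. \<pi> m \<in> carrier L \<and> \<pi> (Suc m) [^]\<^bsub>L\<^esub> p = \<pi> m)"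

definition adjoin_p_roots ::
    "('r, 'm) ring_scheme \<Rightarrow> 'l ring \<Rightarrow> ('r \<Rightarrow> 'l) \<Rightarrow> (nat \<Rightarrow> 'l) \<Rightarrow> 'l ring"
  where "adjoin_p_roots R L j \<pi> =
    L\<lparr>carrier := (\<Union>m. ring.simple_extension L (j ` carrier R) (\<pi> m))\<rparr>"

definition Kcirc ::
    "nat \<Rightarrow> ('r, 'm) ring_scheme \<Rightarrow> 'l ring \<Rightarrow> ('r \<Rightarrow> 'l) \<Rightarrow> (nat \<Rightarrow> 'l) \<Rightarrow> ('r, nat \<Rightarrow> 'l set) module"
  where "Kcirc p R L j \<pi> =
    algebra_via (\<lambda>r. to_completion p (adjoin_p_roots R L j \<pi>) (j r))
      (padic_completion p (adjoin_p_roots R L j \<pi>))"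

definition Kcirc_root ::
    "nat \<Rightarrow> ('r, 'm) ring_scheme \<Rightarrow> 'l ring \<Rightarrow> ('r \<Rightarrow> 'l) \<Rightarrow> (nat \<Rightarrow> 'l) \<Rightarrow> nat \<Rightarrow> (nat \<Rightarrow> 'l set)"
  where "Kcirc_root p R L j \<pi> m = to_completion p (adjoin_p_roots R L j \<pi>) (\<pi> m)"

text \<open>
  The ring automorphisms of \<open>K\<close> that extend \<open>\<sigma>\<close> on \<open>R\<close> and fix the elements \<open>\<rho> m\<close>. On
  \<^const>\<open>Kcirc\<close>, with the roots \<^const>\<open>Kcirc_root\<close> and the Frobenius lift \<open>\<sigma>\<close> of \<open>R\<close>, there is
  exactly one.
\<close>

definition canonical_frobenius ::
    "('r, 'm) ring_scheme \<Rightarrow> ('r \<Rightarrow> 'r) \<Rightarrow> ('r, 'k, 'n) module_scheme \<Rightarrow> (nat \<Rightarrow> 'k) \<Rightarrow> ('k \<Rightarrow> 'k) \<Rightarrow> bool"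
  where "canonical_frobenius R \<sigma> K \<rho> \<Phi> \<longleftrightarrow>
    \<Phi> \<in> ring_iso K K \<and>
    (\<forall>r\<in>carrier R. \<Phi> (structure_map K r) = structure_map K (\<sigma> r)) \<and>
    (\<forall>m. \<Phi> (\<rho> m) = \<rho> m)"

text \<open>Meant for local rings such as \<^const>\<open>Kcirc\<close>.\<close>

definition the_maximal_ideal :: "('k, 'm) ring_scheme \<Rightarrow> 'k set"
  where "the_maximal_ideal K = (THE M. maximalideal M K)"

definition relative_frobenius_lift ::
    "nat \<Rightarrow> ('k, 'm) ring_scheme \<Rightarrow> ('k \<Rightarrow> 'k) \<Rightarrow> ('k, 'c, 'n) module_scheme \<Rightarrow> ('c \<Rightarrow> 'c) \<Rightarrow> bool"
  where "relative_frobenius_lift p K \<Phi> C \<Psi> \<longleftrightarrow>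
    \<Psi> \<in> ring_hom C C \<and>
    (\<forall>k\<in>carrier K. \<Psi> (structure_map C k) = structure_map C (\<Phi> k)) \<and>
    (\<forall>c\<in>carrier C. \<Psi> c \<ominus>\<^bsub>C\<^esub> c [^]\<^bsub>C\<^esub> p \<in> Idl\<^bsub>C\<^esub> (structure_map C ` the_maximal_ideal K))"

section \<open>Tensor product of algebras\<close>

definition monoid_ring :: "('g, 'm) monoid_scheme \<Rightarrow> ('g \<Rightarrow>\<^sub>0 int) ring"
  where "monoid_ring G =
    \<lparr>carrier = {f. Poly_Mapping.keys f \<subseteq> carrier G},
     monoid.mult = (\<lambda>f g. frag_extend (\<lambda>x. frag_extend (\<lambda>y. frag_of (x \<otimes>\<^bsub>G\<^esub> y)) g) f),
     one = frag_of \<one>\<^bsub>G\<^esub>, ring.zero = 0, ring.add = (+)\<rparr>"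

definition tensor_relations ::
    "('r, 'l) ring_scheme \<Rightarrow> ('r, 'a, 'm) module_scheme \<Rightarrow> ('r, 'b, 'n) module_scheme \<Rightarrow>
      ('a \<times> 'b \<Rightarrow>\<^sub>0 int) set"
  where "tensor_relations R A B =
    {frag_of (a \<oplus>\<^bsub>A\<^esub> a', b) - frag_of (a, b) - frag_of (a', b) | a a' b.
        a \<in> carrier A \<and> a' \<in> carrier A \<and> b \<in> carrier B} \<union>
    {frag_of (a, b \<oplus>\<^bsub>B\<^esub> b') - frag_of (a, b) - frag_of (a, b') | a b b'.
        a \<in> carrier A \<and> b \<in> carrier B \<and> b' \<in> carrier B} \<union>
    {frag_of (r \<odot>\<^bsub>A\<^esub> a, b) - frag_of (a, r \<odot>\<^bsub>B\<^esub> b) | r a b.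
        r \<in> carrier R \<and> a \<in> carrier A \<and> b \<in> carrier B}"

text \<open>
  The additive group of the monoid ring of \<open>A \<times> B\<close> is the free abelian group on \<open>A \<times> B\<close>. The
  relations are stable, as a set, under multiplication by the free generators, so the ideal they
  generate is also the subgroup they generate, and the quotient below is the usual \<open>A \<otimes>\<^sub>R B\<close>
  with \<open>(a \<otimes> b) (a' \<otimes> b') = aa' \<otimes> bb'\<close>.
\<close>

definition tensor_ideal ::
    "('r, 'l) ring_scheme \<Rightarrow> ('r, 'a, 'm) module_scheme \<Rightarrow> ('r, 'b, 'n) module_scheme \<Rightarrow>
      ('a \<times> 'b \<Rightarrow>\<^sub>0 int) set"
  where "tensor_ideal R A B = Idl\<^bsub>monoid_ring (A \<times>\<times> B)\<^esub> (tensor_relations R A B)"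

definition pure_tensor ::
    "('r, 'l) ring_scheme \<Rightarrow> ('r, 'a, 'm) module_scheme \<Rightarrow> ('r, 'b, 'n) module_scheme \<Rightarrow>
      'a \<Rightarrow> 'b \<Rightarrow> ('a \<times> 'b \<Rightarrow>\<^sub>0 int) set"
  where "pure_tensor R A B a b = tensor_ideal R A B +>\<^bsub>monoid_ring (A \<times>\<times> B)\<^esub> frag_of (a, b)"

text \<open>\<open>A \<otimes>\<^sub>R B\<close> as a \<open>B\<close>-algebra.\<close>

definition base_change ::
    "('r, 'l) ring_scheme \<Rightarrow> ('r, 'a, 'm) module_scheme \<Rightarrow> ('r, 'b, 'n) module_scheme \<Rightarrow>
      ('b, ('a \<times> 'b \<Rightarrow>\<^sub>0 int) set) module"
  where "base_change R A B =
    algebra_via (pure_tensor R A B \<one>\<^bsub>A\<^esub>) (monoid_ring (A \<times>\<times> B) Quot tensor_ideal R A B)"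

text \<open>The endomorphism \<open>f \<otimes> g\<close>.\<close>

definition tensor_endo ::
    "('r, 'l) ring_scheme \<Rightarrow> ('r, 'a, 'm) module_scheme \<Rightarrow> ('r, 'b, 'n) module_scheme \<Rightarrow>
      ('a \<Rightarrow> 'a) \<Rightarrow> ('b \<Rightarrow> 'b) \<Rightarrow> ('a \<times> 'b \<Rightarrow>\<^sub>0 int) set \<Rightarrow> ('a \<times> 'b \<Rightarrow>\<^sub>0 int) set"
  where "tensor_endo R A B f g S =
    (\<Union>x\<in>S. tensor_ideal R A B +>\<^bsub>monoid_ring (A \<times>\<times> B)\<^esub>
              frag_extend (\<lambda>(a, b). frag_of (f a, g b)) x)"

section \<open>Direct limit along an endomorphism\<close>

text \<open>
  The copies of \<open>A\<close> are numbered from \<open>1\<close>. The equivalence relation is the one generated by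
  \<open>(a, i) \<sim> (\<Phi> a, i + 1)\<close>.
\<close>

definition dirlim_rel :: "('a, 'm) ring_scheme \<Rightarrow> ('a \<Rightarrow> 'a) \<Rightarrow> (('a \<times> nat) \<times> ('a \<times> nat)) set"
  where "dirlim_rel A \<Phi> =
    (let s = {((a, i), (\<Phi> a, Suc i)) | a i. a \<in> carrier A \<and> 1 \<le> i} in (s \<union> s\<inverse>)\<^sup>*)"

definition dirlim_class :: "('a, 'm) ring_scheme \<Rightarrow> ('a \<Rightarrow> 'a) \<Rightarrow> 'a \<Rightarrow> nat \<Rightarrow> ('a \<times> nat) set"
  where "dirlim_class A \<Phi> a i = dirlim_rel A \<Phi> `` {(a, i)}"

text \<open>
  Two classes are added and multiplied by moving representatives with indices \<open>i\<close> and \<open>j\<close> to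
  the index \<open>i + j\<close>.
\<close>

definition dirlim_ring :: "('a, 'm) ring_scheme \<Rightarrow> ('a \<Rightarrow> 'a) \<Rightarrow> ('a \<times> nat) set ring"
  where "dirlim_ring A \<Phi> =
    \<lparr>carrier = (carrier A \<times> {1..}) // dirlim_rel A \<Phi>,
     monoid.mult = (\<lambda>S T. \<Union>(a, i)\<in>S. \<Union>(b, j)\<in>T.
               dirlim_class A \<Phi> ((\<Phi> ^^ j) a \<otimes>\<^bsub>A\<^esub> (\<Phi> ^^ i) b) (i + j)),
     one = dirlim_class A \<Phi> \<one>\<^bsub>A\<^esub> 1,
     ring.zero = dirlim_class A \<Phi> \<zero>\<^bsub>A\<^esub> 1,
     ring.add = (\<lambda>S T. \<Union>(a, i)\<in>S. \<Union>(b, j)\<in>T.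
               dirlim_class A \<Phi> ((\<Phi> ^^ j) a \<oplus>\<^bsub>A\<^esub> (\<Phi> ^^ i) b) (i + j))\<rparr>"

text \<open>
  If \<open>A\<close> is an algebra over \<open>K\<close>, its direct limit is a \<open>K\<close>-algebra through the first copy of \<open>A\<close>:
  the structure map is \<open>k \<mapsto> [k\<cdot>1, 1]\<close>. For \<open>\<Phi>\<close> semilinear over an endomorphism \<open>\<psi>\<close> of \<open>K\<close> this
  means \<open>k [a, i] = [\<psi>\<^bsup>i-1\<^esup>(k) a, i]\<close>.
\<close>

definition dirlim :: "('k, 'a, 'm) module_scheme \<Rightarrow> ('a \<Rightarrow> 'a) \<Rightarrow> ('k, ('a \<times> nat) set) module"
  where "dirlim A \<Phi> = algebra_via (\<lambda>k. dirlim_class A \<Phi> (structure_map A k) 1) (dirlim_ring A \<Phi>)"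

definition dirlim_endo :: "('a, 'm) ring_scheme \<Rightarrow> ('a \<Rightarrow> 'a) \<Rightarrow> ('a \<times> nat) set \<Rightarrow> ('a \<times> nat) set"
  where "dirlim_endo A \<Phi> S = (\<Union>(a, i)\<in>S. dirlim_class A \<Phi> (\<Phi> a) i)"

section \<open>The algebra \<open>P\<degree>(A, \<phi>)\<close>\<close>

text \<open>The direct limit \<open>\<B>'\<close> of \<open>\<A> = A \<otimes>\<^sub>R K\<close> along \<open>\<Phi> = \<phi> \<otimes> \<Phi>\<^sub>K\<close>.\<close>

definition perfection ::
    "('r, 'l) ring_scheme \<Rightarrow> ('r, 'k, 'n) module_scheme \<Rightarrow> ('k \<Rightarrow> 'k) \<Rightarrow>
      ('r, 'a, 'm) module_scheme \<Rightarrow> ('a \<Rightarrow> 'a) \<Rightarrow>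
      ('k, (('a \<times> 'k \<Rightarrow>\<^sub>0 int) set \<times> nat) set) module"
  where "perfection R K \<Phi>\<^sub>K A \<phi> = dirlim (base_change R A K) (tensor_endo R A K \<phi> \<Phi>\<^sub>K)"

definition perfection_endo ::
    "('r, 'l) ring_scheme \<Rightarrow> ('r, 'k, 'n) module_scheme \<Rightarrow> ('k \<Rightarrow> 'k) \<Rightarrow>
      ('r, 'a, 'm) module_scheme \<Rightarrow> ('a \<Rightarrow> 'a) \<Rightarrow>
      (('a \<times> 'k \<Rightarrow>\<^sub>0 int) set \<times> nat) set \<Rightarrow> (('a \<times> 'k \<Rightarrow>\<^sub>0 int) set \<times> nat) set"
  where "perfection_endo R K \<Phi>\<^sub>K A \<phi> =
    dirlim_endo (base_change R A K) (tensor_endo R A K \<phi> \<Phi>\<^sub>K)"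

definition Pcirc ::
    "nat \<Rightarrow> ('r, 'l) ring_scheme \<Rightarrow> ('r, 'k, 'n) module_scheme \<Rightarrow> ('k \<Rightarrow> 'k) \<Rightarrow>
      ('r, 'a, 'm) module_scheme \<Rightarrow> ('a \<Rightarrow> 'a) \<Rightarrow>
      ('k, nat \<Rightarrow> (('a \<times> 'k \<Rightarrow>\<^sub>0 int) set \<times> nat) set set) module"
  where "Pcirc p R K \<Phi>\<^sub>K A \<phi> =
    algebra_via
      (\<lambda>k. to_completion p (perfection R K \<Phi>\<^sub>K A \<phi>) (structure_map (perfection R K \<Phi>\<^sub>K A \<phi>) k))
      (padic_completion p (perfection R K \<Phi>\<^sub>K A \<phi>))"

definition Pcirc_endo ::
    "nat \<Rightarrow> ('r, 'l) ring_scheme \<Rightarrow> ('r, 'k, 'n) module_scheme \<Rightarrow> ('k \<Rightarrow> 'k) \<Rightarrow>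
      ('r, 'a, 'm) module_scheme \<Rightarrow> ('a \<Rightarrow> 'a) \<Rightarrow>
      (nat \<Rightarrow> (('a \<times> 'k \<Rightarrow>\<^sub>0 int) set \<times> nat) set set) \<Rightarrow>
      (nat \<Rightarrow> (('a \<times> 'k \<Rightarrow>\<^sub>0 int) set \<times> nat) set set)"
  where "Pcirc_endo p R K \<Phi>\<^sub>K A \<phi> =
    completion_endo p (perfection R K \<Phi>\<^sub>K A \<phi>) (perfection_endo R K \<Phi>\<^sub>K A \<phi>)"

text \<open>The map \<open>a \<mapsto> [a \<otimes> 1, 1]\<close>.\<close>

definition Pcirc_incl ::
    "nat \<Rightarrow> ('r, 'l) ring_scheme \<Rightarrow> ('r, 'k, 'n) module_scheme \<Rightarrow> ('k \<Rightarrow> 'k) \<Rightarrow>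
      ('r, 'a, 'm) module_scheme \<Rightarrow> ('a \<Rightarrow> 'a) \<Rightarrow>
      'a \<Rightarrow> (nat \<Rightarrow> (('a \<times> 'k \<Rightarrow>\<^sub>0 int) set \<times> nat) set set)"
  where "Pcirc_incl p R K \<Phi>\<^sub>K A \<phi> a =
    to_completion p (perfection R K \<Phi>\<^sub>K A \<phi>)
      (dirlim_class (base_change R A K) (tensor_endo R A K \<phi> \<Phi>\<^sub>K)
        (pure_tensor R A K a \<one>\<^bsub>K\<^esub>) 1)"

end

theory Submission
  imports Defs
begin

text \<open>
  A homomorphism out of \<open>P\<degree>(A, \<phi>)\<close> is determined step by step. The map \<open>a \<otimes> k \<mapsto> k u\<^sub>1(a)\<close> is the only
  \<open>K\<close>-algebra map on \<open>\<A>\<close> extending \<open>u\<^sub>1\<close>, and it intertwines \<open>\<Phi>\<close> with \<open>\<Phi>\<^sub>C\<close>. As \<open>\<Phi>\<^sub>C\<close> is bijective,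
  it extends uniquely to the direct limit by \<open>[a, i] \<mapsto> \<Phi>\<^sub>C\<^bsup>1-i\<^esup>(u(a))\<close>, and then to the completion
  because \<open>C\<close> is complete and any ring homomorphism is \<open>p\<close>-adically continuous. That
  \<open>\<phi> \<otimes> \<Phi>\<close> is well defined needs \<open>\<phi>\<close> to be semilinear over the Frobenius lift \<open>\<sigma>\<close> of \<open>R\<close>. This is
  automatic: the two maps \<open>R \<rightarrow> A\<close> in question agree modulo \<open>p\<close>, and since every element of \<open>R\<close> has
  the form \<open>x\<^sup>p + p y\<close>, agreement modulo \<open>p\<^sup>n\<close> implies agreement modulo \<open>p\<^bsup>n+1\<^esup>\<close>.
\<close>

section \<open>The integral monoid ring\<close>

text \<open>The completion is an inverse limit, with the topology given by the kernels of its
  projections to \<open>B/p^n\<close>, whereas a ring homomorphism is only controlled on multiples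
  of \<open>p^n\<close>. Uniqueness on the completion rests on the two agreeing: the ideal is
  generated by the single element \<open>p\<close>, so an element of the limit is a constant plus
  \<open>p^n\<close> times another element of the limit. No inverse of \<open>\<Phi>\<^sub>C\<close>
  is formed. The value at \<open>[a, i]\<close> is the unique solution of an equation between powers
  of \<open>\<Phi>\<^sub>C\<close>, and injectivity reduces every law for the extension to the
  corresponding law for the given map. A scalar \<open>k\<close> acts on the limit and on its
  completion as multiplication by the image of \<open>[1 \<otimes> k, 1]\<close>. A
  \<open>K\<close>-algebra homomorphism is therefore a ring homomorphism with prescribed values on
  these elements, and each stage can be carried out for ring homomorphisms alone. The operations of
  the direct limit and the three induced endomorphisms are unions over representatives, so each must
  be shown independent of the choice.\<close>

lemma frag_extend_add_fun:
  "frag_extend (\<lambda>x. f x + g x) c = frag_extend f c + frag_extend g c"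
  by (simp add: frag_extend_def frag_cmul_distrib2 sum.distrib)

text \<open>Closure under differences replaces separate cases for sums and negatives in every
  induction over the free abelian group.\<close>

lemmas frag_diff_induct = free_Abelian_group_induct [consumes 1, case_names zero diff single]

lemma keys_diff_subsetI:
  "\<lbrakk>Poly_Mapping.keys x \<subseteq> S; Poly_Mapping.keys y \<subseteq> S\<rbrakk> \<Longrightarrow> Poly_Mapping.keys (x - y) \<subseteq> S"
  for x y :: "'a \<Rightarrow>\<^sub>0 int"
  using keys_diff [of x y] by blast

lemma keys_add_subsetI:
  "\<lbrakk>Poly_Mapping.keys x \<subseteq> S; Poly_Mapping.keys y \<subseteq> S\<rbrakk> \<Longrightarrow> Poly_Mapping.keys (x + y) \<subseteq> S"
  for x y :: "'a \<Rightarrow>\<^sub>0 int"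
  using keys_add [of x y] by blast

lemma monoid_ring_simps [simp]:
  "f \<in> carrier (monoid_ring G) \<longleftrightarrow> Poly_Mapping.keys f \<subseteq> carrier G"
  "\<zero>\<^bsub>monoid_ring G\<^esub> = 0"
  "\<one>\<^bsub>monoid_ring G\<^esub> = frag_of \<one>\<^bsub>G\<^esub>"
  "f \<oplus>\<^bsub>monoid_ring G\<^esub> g = f + g"
  by (simp_all add: monoid_ring_def)

lemma monoid_ring_mult_of [simp]:
  "frag_of x \<otimes>\<^bsub>monoid_ring G\<^esub> frag_of y = frag_of (x \<otimes>\<^bsub>G\<^esub> y)"
  by (simp add: monoid_ring_def)

lemma monoid_ring_mult_left [simp]:
  "0 \<otimes>\<^bsub>monoid_ring G\<^esub> h = 0"
  "(f + g) \<otimes>\<^bsub>monoid_ring G\<^esub> h = f \<otimes>\<^bsub>monoid_ring G\<^esub> h + g \<otimes>\<^bsub>monoid_ring G\<^esub> h"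
  "(f - g) \<otimes>\<^bsub>monoid_ring G\<^esub> h = f \<otimes>\<^bsub>monoid_ring G\<^esub> h - g \<otimes>\<^bsub>monoid_ring G\<^esub> h"
  by (simp_all add: monoid_ring_def frag_extend_add frag_extend_diff)

lemma monoid_ring_mult_right [simp]:
  "h \<otimes>\<^bsub>monoid_ring G\<^esub> 0 = 0"
  "h \<otimes>\<^bsub>monoid_ring G\<^esub> (f + g) = h \<otimes>\<^bsub>monoid_ring G\<^esub> f + h \<otimes>\<^bsub>monoid_ring G\<^esub> g"
  "h \<otimes>\<^bsub>monoid_ring G\<^esub> (f - g) = h \<otimes>\<^bsub>monoid_ring G\<^esub> f - h \<otimes>\<^bsub>monoid_ring G\<^esub> g"
proof -
  show 0: "h \<otimes>\<^bsub>monoid_ring G\<^esub> 0 = 0"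
    by (simp add: monoid_ring_def frag_extend_eq_0)
  show add: "h \<otimes>\<^bsub>monoid_ring G\<^esub> (f + g) = h \<otimes>\<^bsub>monoid_ring G\<^esub> f + h \<otimes>\<^bsub>monoid_ring G\<^esub> g" for f g
    by (simp add: monoid_ring_def frag_extend_add frag_extend_add_fun)
  show "h \<otimes>\<^bsub>monoid_ring G\<^esub> (f - g) = h \<otimes>\<^bsub>monoid_ring G\<^esub> f - h \<otimes>\<^bsub>monoid_ring G\<^esub> g"
    using add [of "f - g" g] by simp
qed

context comm_monoid
begin

lemma monoid_ring_mult_closed:
  assumes "Poly_Mapping.keys f \<subseteq> carrier G" "Poly_Mapping.keys g \<subseteq> carrier G"
  shows "Poly_Mapping.keys (f \<otimes>\<^bsub>monoid_ring G\<^esub> g) \<subseteq> carrier G"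
  using assms(1)
proof (induction f rule: frag_diff_induct)
  case (single a)
  from assms(2) show ?case
  proof (induction g rule: frag_diff_induct)
    case (diff x y)
    then show ?case by (simp add: keys_diff_subsetI)
  qed (use single in auto)
qed (simp_all add: keys_diff_subsetI)

lemma monoid_ring_comm:
  assumes "Poly_Mapping.keys f \<subseteq> carrier G" "Poly_Mapping.keys g \<subseteq> carrier G"
  shows "f \<otimes>\<^bsub>monoid_ring G\<^esub> g = g \<otimes>\<^bsub>monoid_ring G\<^esub> f"
  using assms(1)
proof (induction f rule: frag_diff_induct)
  case (single a)
  from assms(2) show ?case
    by (induction g rule: frag_diff_induct) (use single in \<open>auto simp: m_comm\<close>)
qed auto

lemma monoid_ring_assoc:
  assumes "Poly_Mapping.keys f \<subseteq> carrier G" "Poly_Mapping.keys g \<subseteq> carrier G"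
    "Poly_Mapping.keys h \<subseteq> carrier G"
  shows "f \<otimes>\<^bsub>monoid_ring G\<^esub> g \<otimes>\<^bsub>monoid_ring G\<^esub> h = f \<otimes>\<^bsub>monoid_ring G\<^esub> (g \<otimes>\<^bsub>monoid_ring G\<^esub> h)"
  using assms(1)
proof (induction f rule: frag_diff_induct)
  case f: (single a)
  from assms(2) show ?case
  proof (induction g rule: frag_diff_induct)
    case g: (single b)
    from assms(3) show ?case
      by (induction h rule: frag_diff_induct) (use f g in \<open>auto simp: m_assoc\<close>)
  qed auto
qed auto

lemma monoid_ring_l_one:
  assumes "Poly_Mapping.keys f \<subseteq> carrier G"
  shows "frag_of \<one> \<otimes>\<^bsub>monoid_ring G\<^esub> f = f"
  using assms by (induction f rule: frag_diff_induct) auto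

lemma monoid_ring_cring: "cring (monoid_ring G)"
proof (intro cringI abelian_groupI comm_monoidI)
  fix f assume "f \<in> carrier (monoid_ring G)"
  then show "\<exists>g\<in>carrier (monoid_ring G). g \<oplus>\<^bsub>monoid_ring G\<^esub> f = \<zero>\<^bsub>monoid_ring G\<^esub>"
    by (intro bexI [of _ "- f"]) auto
next
  fix f g assume "f \<in> carrier (monoid_ring G)" "g \<in> carrier (monoid_ring G)"
  then show "f \<otimes>\<^bsub>monoid_ring G\<^esub> g = g \<otimes>\<^bsub>monoid_ring G\<^esub> f"
    by (simp add: monoid_ring_comm)
qed (simp_all add: monoid_ring_assoc monoid_ring_l_one add_ac
    keys_add_subsetI monoid_ring_mult_closed)

text \<open>The tensor relations and the induction principle are written with the difference of
  finitely supported functions, ideals and homomorphisms with the subtraction of the ring; this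
  identifies the two.\<close>

lemma monoid_ring_minus:
  assumes "Poly_Mapping.keys g \<subseteq> carrier G"
  shows "f \<ominus>\<^bsub>monoid_ring G\<^esub> g = f - g"
proof -
  interpret M: cring "monoid_ring G" by (rule monoid_ring_cring)
  have "\<ominus>\<^bsub>monoid_ring G\<^esub> g = - g"
    by (rule M.minus_equality) (use assms in auto)
  then show ?thesis by (simp add: M.minus_eq)
qed

section \<open>Homomorphisms out of the monoid ring\<close>

text \<open>Both sides of multiplicativity are biadditive, so it spreads from the generators by
  induction on one factor and then on the other.\<close>

lemma monoid_ring_hom_multI:
  assumes C: "ring C"
    and H: "H \<in> hom (free_Abelian_group (carrier G)) (add_monoid C)"
    and one: "H (frag_of \<one>) = \<one>\<^bsub>C\<^esub>"
    and mult: "\<And>x y. \<lbrakk>x \<in> carrier G; y \<in> carrier G\<rbrakk> \<Longrightarrow>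
      H (frag_of (x \<otimes> y)) = H (frag_of x) \<otimes>\<^bsub>C\<^esub> H (frag_of y)"
  shows "H \<in> ring_hom (monoid_ring G) C"
proof -
  interpret C: ring C by fact
  have closed: "H f \<in> carrier C" if "Poly_Mapping.keys f \<subseteq> carrier G" for f
    using hom_carrier [OF H] that by (simp add: image_subset_iff)
  have add: "H (f + g) = H f \<oplus>\<^bsub>C\<^esub> H g"
    if "Poly_Mapping.keys f \<subseteq> carrier G" "Poly_Mapping.keys g \<subseteq> carrier G" for f g
    using hom_mult [OF H, of f g] that by simp
  have H_diff: "H (f - g) = H f \<ominus>\<^bsub>C\<^esub> H g"
    if "Poly_Mapping.keys f \<subseteq> carrier G" "Poly_Mapping.keys g \<subseteq> carrier G" for f g
  proof -
    have k: "Poly_Mapping.keys (f - g) \<subseteq> carrier G"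
      using that by (simp add: keys_diff_subsetI)
    have "H f = H (f - g) \<oplus>\<^bsub>C\<^esub> H g" using add [OF k that(2)] by (simp only: diff_add_cancel)
    with closed [OF k] closed [OF that(2)] closed [OF that(1)] show ?thesis
      by (metis C.minus_eq C.r_neg C.a_assoc C.r_zero C.a_inv_closed)
  qed
  have zero0: "H 0 = \<zero>\<^bsub>C\<^esub>"
  proof -
    have "H 0 \<oplus>\<^bsub>C\<^esub> H 0 = H 0" using add [of 0 0, symmetric] by simp
    then show ?thesis using closed [of 0] C.add.r_cancel_one [of "H 0" "H 0"] by simp
  qed
  have mult': "H (f \<otimes>\<^bsub>monoid_ring G\<^esub> g) = H f \<otimes>\<^bsub>C\<^esub> H g"
    if "Poly_Mapping.keys f \<subseteq> carrier G" "Poly_Mapping.keys g \<subseteq> carrier G" for f g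
    using that(1)
  proof (induction f rule: frag_diff_induct)
    case zero
    then show ?case using zero0 closed [OF that(2)] by simp
  next
    case (diff x y)
    have "H ((x - y) \<otimes>\<^bsub>monoid_ring G\<^esub> g)
        = H (x \<otimes>\<^bsub>monoid_ring G\<^esub> g) \<ominus>\<^bsub>C\<^esub> H (y \<otimes>\<^bsub>monoid_ring G\<^esub> g)"
      unfolding monoid_ring_mult_left
      by (intro H_diff monoid_ring_mult_closed diff that)
    also have "\<dots> = (H x \<ominus>\<^bsub>C\<^esub> H y) \<otimes>\<^bsub>C\<^esub> H g"
      using closed [OF diff(1)] closed [OF diff(2)] closed [OF that(2)] diff(3,4)
      by (simp only: C.minus_eq C.l_distr C.l_minus C.a_inv_closed)
    finally show ?case
      by (simp only: H_diff [OF diff(1,2)])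
  next
    case (single a)
    note a = this
    from that(2) show ?case
    proof (induction g rule: frag_diff_induct)
      case zero
      then show ?case using zero0 closed [of "frag_of a"] a by simp
    next
      case (diff x y)
      have fa: "Poly_Mapping.keys (frag_of a) \<subseteq> carrier G" using a by simp
      have "H (frag_of a \<otimes>\<^bsub>monoid_ring G\<^esub> (x - y))
          = H (frag_of a \<otimes>\<^bsub>monoid_ring G\<^esub> x) \<ominus>\<^bsub>C\<^esub> H (frag_of a \<otimes>\<^bsub>monoid_ring G\<^esub> y)"
        unfolding monoid_ring_mult_right
        by (intro H_diff monoid_ring_mult_closed diff fa)
      also have "\<dots> = H (frag_of a) \<otimes>\<^bsub>C\<^esub> (H x \<ominus>\<^bsub>C\<^esub> H y)"
        using closed [OF diff(1)] closed [OF diff(2)] closed [OF fa] diff(3,4)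
        by (simp only: C.minus_eq C.r_distr C.r_minus C.a_inv_closed)
      finally show ?case
        by (simp only: H_diff [OF diff(1,2)])
    qed (use a mult in simp)
  qed
  show ?thesis
    by (rule ring_hom_memI) (simp_all add: closed add mult' one)
qed

text \<open>The universal property of the monoid ring. Freeness supplies only an additive extension;
  its multiplicativity is then a matter of generators.\<close>

lemma monoid_ring_lift:
  assumes C: "ring C"
    and h: "\<And>x. x \<in> carrier G \<Longrightarrow> h x \<in> carrier C" "h \<one> = \<one>\<^bsub>C\<^esub>"
      "\<And>x y. \<lbrakk>x \<in> carrier G; y \<in> carrier G\<rbrakk> \<Longrightarrow> h (x \<otimes> y) = h x \<otimes>\<^bsub>C\<^esub> h y"
  shows "\<exists>H\<in>ring_hom (monoid_ring G) C. \<forall>x\<in>carrier G. H (frag_of x) = h x"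
proof -
  interpret C: ring C by fact
  from h(1) have "h ` carrier G \<subseteq> carrier (add_monoid C)" by auto
  then obtain H where H: "H \<in> hom (free_Abelian_group (carrier G)) (add_monoid C)"
    "\<And>x. x \<in> carrier G \<Longrightarrow> H (frag_of x) = h x"
    by (rule comm_group.free_Abelian_group_universal [OF C.a_comm_group]) blast
  have "H \<in> ring_hom (monoid_ring G) C"
    by (rule monoid_ring_hom_multI [OF C H(1)]) (simp_all add: H(2) h)
  with H(2) show ?thesis by blast
qed

text \<open>Here the extension must be the explicit map that occurs in \<open>tensor_endo\<close>,
  so the existence statement of \<open>monoid_ring_lift\<close> would not serve.\<close>

lemma monoid_ring_endo:
  assumes k: "\<And>x. x \<in> carrier G \<Longrightarrow> k x \<in> carrier G" "k \<one> = \<one>"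
      "\<And>x y. \<lbrakk>x \<in> carrier G; y \<in> carrier G\<rbrakk> \<Longrightarrow> k (x \<otimes> y) = k x \<otimes> k y"
  shows "frag_extend (\<lambda>x. frag_of (k x)) \<in> ring_hom (monoid_ring G) (monoid_ring G)"
proof (rule monoid_ring_hom_multI)
  show "ring (monoid_ring G)" by (rule cring.axioms(1) [OF monoid_ring_cring])
  show "frag_extend (\<lambda>x. frag_of (k x)) \<in> hom (free_Abelian_group (carrier G)) (add_monoid (monoid_ring G))"
  proof (rule homI)
    fix f assume f: "f \<in> carrier (free_Abelian_group (carrier G))"
    have "Poly_Mapping.keys (frag_extend (\<lambda>x. frag_of (k x)) f)
        \<subseteq> (\<Union>x \<in> Poly_Mapping.keys f. Poly_Mapping.keys (frag_of (k x)))"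
      by (rule keys_frag_extend)
    also have "\<dots> \<subseteq> carrier G" using f k(1) by auto
    finally show "frag_extend (\<lambda>x. frag_of (k x)) f \<in> carrier (add_monoid (monoid_ring G))"
      by simp
  qed (simp add: frag_extend_add)
qed (use k in auto)

lemma monoid_ring_hom_ext:
  assumes C: "ring C" and "H \<in> ring_hom (monoid_ring G) C" "H' \<in> ring_hom (monoid_ring G) C"
    and eq: "\<And>x. x \<in> carrier G \<Longrightarrow> H (frag_of x) = H' (frag_of x)"
    and f: "f \<in> carrier (monoid_ring G)"
  shows "H f = H' f"
proof -
  interpret M: cring "monoid_ring G" by (rule monoid_ring_cring)
  interpret C: ring C by fact
  interpret H: ring_hom_ring "monoid_ring G" C H
    by unfold_locales fact
  interpret H': ring_hom_ring "monoid_ring G" C H'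
    by unfold_locales fact
  have "Poly_Mapping.keys f \<subseteq> carrier G" using f by simp
  then show ?thesis
  proof (induction f rule: frag_diff_induct)
    case zero
    then show ?case using H.hom_zero H'.hom_zero by simp
  next
    case (diff x y)
    then have "x \<in> carrier (monoid_ring G)" "y \<in> carrier (monoid_ring G)" by simp_all
    with diff show ?case
      by (simp add: monoid_ring_minus [symmetric] M.minus_eq del: monoid_ring_simps)
  qed (rule eq)
qed

end

section \<open>Factoring homomorphisms through quotient rings\<close>

lemma quotient_lift:
  assumes "ring M" "ideal I M" "ring S" "H \<in> ring_hom M S"
    and kernel: "\<And>x. x \<in> I \<Longrightarrow> H x = \<zero>\<^bsub>S\<^esub>"
  shows "\<exists>v\<in>ring_hom (M Quot I) S. \<forall>x\<in>carrier M. v (I +>\<^bsub>M\<^esub> x) = H x"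
proof -
  interpret ideal I M by fact
  interpret S: ring S by fact
  interpret H: ring_hom_ring M S H by unfold_locales fact
  \<comment> \<open>\<open>H\<close> is constant on each coset of \<open>I\<close>, so the image of
    a coset is a singleton and no representative has to be chosen.\<close>
  define v where "v = (\<lambda>Q. the_elem (H ` Q))"
  have v: "v (I +>\<^bsub>M\<^esub> x) = H x" if x: "x \<in> carrier M" for x
  proof -
    have "H y = H x" if "y \<in> I +>\<^bsub>M\<^esub> x" for y
      using that x by (auto simp: a_r_coset_def' kernel)
    with a_rcos_self [OF x] have "H ` (I +>\<^bsub>M\<^esub> x) = {H x}" by blast
    then show ?thesis by (simp add: v_def)
  qed
  have "v \<in> ring_hom (M Quot I) S"
  proof (rule ring_hom_memI)
    show "v \<one>\<^bsub>M Quot I\<^esub> = \<one>\<^bsub>S\<^esub>" by (simp add: FactRing_def v)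
  qed (auto simp: FactRing_simps v rcoset_mult_add a_rcos_sum)
  with v show ?thesis by blast
qed

section \<open>Base change of algebras\<close>

lemma algebra_via_simps [simp]:
  "carrier (algebra_via f B) = carrier B"
  "x \<otimes>\<^bsub>algebra_via f B\<^esub> y = x \<otimes>\<^bsub>B\<^esub> y"
  "x \<oplus>\<^bsub>algebra_via f B\<^esub> y = x \<oplus>\<^bsub>B\<^esub> y"
  "\<one>\<^bsub>algebra_via f B\<^esub> = \<one>\<^bsub>B\<^esub>"
  "\<zero>\<^bsub>algebra_via f B\<^esub> = \<zero>\<^bsub>B\<^esub>"
  "k \<odot>\<^bsub>algebra_via f B\<^esub> x = f k \<otimes>\<^bsub>B\<^esub> x"
  by (simp_all add: algebra_via_def)

text \<open>Ring homomorphisms do not see the scalar action, so they can be constructed on the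
  underlying rings and transferred.\<close>

lemma ring_hom_algebra_via [simp]:
  "ring_hom A (algebra_via f B) = ring_hom A B"
  "ring_hom (algebra_via f B) A = ring_hom B A"
  by (simp_all add: ring_hom_def)

lemma cring_algebra_via: "cring B \<Longrightarrow> cring (algebra_via f B)"
proof -
  assume "cring B"
  then interpret B: cring B .
  show ?thesis
  proof (intro cringI abelian_groupI comm_monoidI)
    fix x assume "x \<in> carrier (algebra_via f B)"
    then show "\<exists>y\<in>carrier (algebra_via f B). y \<oplus>\<^bsub>algebra_via f B\<^esub> x = \<zero>\<^bsub>algebra_via f B\<^esub>"
      using B.add.l_inv_ex by simp
  qed (simp_all add: B.a_ac B.m_ac B.l_distr B.r_distr)
qed

lemma (in ideal) rcos_eqI:
  assumes "x \<in> carrier R" "y \<in> carrier R" "x \<ominus> y \<in> I"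
  shows "I +> x = I +> y"
  using assms quotient_eq_iff_same_a_r_cos [OF ideal_axioms] by simp

lemma (in ideal) rcos_eqD:
  assumes "x \<in> carrier R" "y \<in> carrier R" "I +> x = I +> y"
  shows "x \<ominus> y \<in> I"
  using assms quotient_eq_iff_same_a_r_cos [OF ideal_axioms] by simp

section \<open>Tensor products of commutative algebras\<close>

text \<open>Closure of both scalar actions is what places the tensor relations inside the monoid
  ring, so that they generate an ideal there.\<close>

locale tensor_algebras = A: cring A + B: cring B
  for R :: "('r, 'l) ring_scheme" and A :: "('r, 'a, 'm) module_scheme"
    and B :: "('r, 'b, 'n) module_scheme" +
  assumes smult_closed_left: "\<lbrakk>r \<in> carrier R; a \<in> carrier A\<rbrakk> \<Longrightarrow> r \<odot>\<^bsub>A\<^esub> a \<in> carrier A"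
    and smult_closed_right: "\<lbrakk>r \<in> carrier R; b \<in> carrier B\<rbrakk> \<Longrightarrow> r \<odot>\<^bsub>B\<^esub> b \<in> carrier B"
begin

lemma comm_monoid_DirProd: "comm_monoid (A \<times>\<times> B)"
  by (intro comm_monoidI) (auto simp: A.m_ac B.m_ac)

lemmas cring_generators = comm_monoid.monoid_ring_cring [OF comm_monoid_DirProd]

lemma tensor_relations_subset: "tensor_relations R A B \<subseteq> carrier (monoid_ring (A \<times>\<times> B))"
  unfolding tensor_relations_def
  by (intro subsetI, elim UnE CollectE exE conjE)
    (simp_all add: smult_closed_left smult_closed_right keys_diff_subsetI)

lemma ideal_tensor: "ideal (tensor_ideal R A B) (monoid_ring (A \<times>\<times> B))"
  unfolding tensor_ideal_def
  by (intro ring.genideal_ideal cring.axioms(1) cring_generators tensor_relations_subset)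

lemma cring_base_change: "cring (base_change R A B)"
  unfolding base_change_def
  by (intro cring_algebra_via ideal.quotient_is_cring ideal_tensor cring_generators)

lemma tensor_relations_in_ideal: "tensor_relations R A B \<subseteq> tensor_ideal R A B"
  unfolding tensor_ideal_def
  by (intro ring.genideal_self cring.axioms(1) cring_generators tensor_relations_subset)

lemma pure_tensor_closed:
  "\<lbrakk>a \<in> carrier A; b \<in> carrier B\<rbrakk> \<Longrightarrow> pure_tensor R A B a b \<in> carrier (base_change R A B)"
  using ring_hom_closed [OF ideal.rcos_ring_hom [OF ideal_tensor], of "frag_of (a, b)"]
  by (simp add: base_change_def pure_tensor_def)

lemma pure_tensor_mult:
  assumes "a \<in> carrier A" "b \<in> carrier B" "a' \<in> carrier A" "b' \<in> carrier B"
  shows "pure_tensor R A B a b \<otimes>\<^bsub>base_change R A B\<^esub> pure_tensor R A B a' b'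
    = pure_tensor R A B (a \<otimes>\<^bsub>A\<^esub> a') (b \<otimes>\<^bsub>B\<^esub> b')"
  unfolding base_change_def pure_tensor_def
  using assms by (simp add: FactRing_def ideal.rcoset_mult_add [OF ideal_tensor])

lemma pure_tensor_one: "\<one>\<^bsub>base_change R A B\<^esub> = pure_tensor R A B \<one>\<^bsub>A\<^esub> \<one>\<^bsub>B\<^esub>"
  unfolding base_change_def pure_tensor_def by (simp add: FactRing_def)

lemma structure_map_base_change:
  "b \<in> carrier B \<Longrightarrow> structure_map (base_change R A B) b = pure_tensor R A B \<one>\<^bsub>A\<^esub> b"
  using pure_tensor_mult [of "\<one>\<^bsub>A\<^esub>" b "\<one>\<^bsub>A\<^esub>" "\<one>\<^bsub>B\<^esub>"]
  unfolding structure_map_def pure_tensor_one by (simp add: base_change_def)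

lemma pure_tensor_split:
  assumes "a \<in> carrier A" "b \<in> carrier B"
  shows "pure_tensor R A B a b
    = pure_tensor R A B a \<one>\<^bsub>B\<^esub> \<otimes>\<^bsub>base_change R A B\<^esub> pure_tensor R A B \<one>\<^bsub>A\<^esub> b"
  using assms by (simp add: pure_tensor_mult)

text \<open>Composed with the quotient map, both become homomorphisms on the monoid ring, where
  generators decide; sums of pure tensors never have to be written out.\<close>

lemma base_change_hom_ext:
  assumes "ring C" "v \<in> ring_hom (base_change R A B) C" "v' \<in> ring_hom (base_change R A B) C"
    and eq: "\<And>a b. \<lbrakk>a \<in> carrier A; b \<in> carrier B\<rbrakk> \<Longrightarrow>
      v (pure_tensor R A B a b) = v' (pure_tensor R A B a b)"
    and x: "x \<in> carrier (base_change R A B)"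
  shows "v x = v' x"
proof -
  let ?M = "monoid_ring (A \<times>\<times> B)" and ?q = "(+>\<^bsub>monoid_ring (A \<times>\<times> B)\<^esub>) (tensor_ideal R A B)"
  have q: "?q \<in> ring_hom ?M (base_change R A B)"
    using ideal.rcos_ring_hom [OF ideal_tensor] by (simp add: base_change_def)
  from x obtain f where f: "f \<in> carrier ?M" "x = ?q f"
    by (auto simp: base_change_def FactRing_def A_RCOSETS_def')
  have "(v \<circ> ?q) f = (v' \<circ> ?q) f"
    by (rule comm_monoid.monoid_ring_hom_ext [OF comm_monoid_DirProd \<open>ring C\<close>
        ring_hom_trans [OF q assms(2)] ring_hom_trans [OF q assms(3)] _ f(1)])
      (use eq in \<open>auto simp: pure_tensor_def\<close>)
  with f show ?thesis by simp
qed

text \<open>The universal property of the tensor product as a pushout. The balance condition on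
  products expresses that the two maps agree on \<open>R\<close> without giving \<open>C\<close> an
  \<open>R\<close>-algebra structure.\<close>

lemma base_change_lift:
  assumes C: "cring C" and \<alpha>: "\<alpha> \<in> ring_hom A C" and \<beta>: "\<beta> \<in> ring_hom B C"
    and balanced: "\<And>r a b. \<lbrakk>r \<in> carrier R; a \<in> carrier A; b \<in> carrier B\<rbrakk> \<Longrightarrow>
      \<alpha> (r \<odot>\<^bsub>A\<^esub> a) \<otimes>\<^bsub>C\<^esub> \<beta> b = \<alpha> a \<otimes>\<^bsub>C\<^esub> \<beta> (r \<odot>\<^bsub>B\<^esub> b)"
  shows "\<exists>v\<in>ring_hom (base_change R A B) C. \<forall>a\<in>carrier A. \<forall>b\<in>carrier B.
    v (pure_tensor R A B a b) = \<alpha> a \<otimes>\<^bsub>C\<^esub> \<beta> b"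
proof -
  let ?M = "monoid_ring (A \<times>\<times> B)"
  interpret C: cring C by fact
  interpret M: cring ?M by (rule cring_generators)
  note \<alpha>' = ring_hom_closed [OF \<alpha>] ring_hom_add [OF \<alpha>] ring_hom_mult [OF \<alpha>] ring_hom_one [OF \<alpha>]
  note \<beta>' = ring_hom_closed [OF \<beta>] ring_hom_add [OF \<beta>] ring_hom_mult [OF \<beta>] ring_hom_one [OF \<beta>]
  have "\<exists>H\<in>ring_hom ?M C. \<forall>x\<in>carrier (A \<times>\<times> B). H (frag_of x) = \<alpha> (fst x) \<otimes>\<^bsub>C\<^esub> \<beta> (snd x)"
    by (rule comm_monoid.monoid_ring_lift [OF comm_monoid_DirProd C.ring_axioms])
      (auto simp: \<alpha>' \<beta>' C.m_ac)
  then obtain H where H: "H \<in> ring_hom ?M C"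
    "\<forall>x\<in>carrier (A \<times>\<times> B). H (frag_of x) = \<alpha> (fst x) \<otimes>\<^bsub>C\<^esub> \<beta> (snd x)"
    by blast
  interpret H: ring_hom_ring ?M C H by unfold_locales fact
  have H_diff: "H (f - g) = H f \<ominus>\<^bsub>C\<^esub> H g"
    if "Poly_Mapping.keys f \<subseteq> carrier A \<times> carrier B" "Poly_Mapping.keys g \<subseteq> carrier A \<times> carrier B" for f g
  proof -
    have "f \<in> carrier ?M" "g \<in> carrier ?M" using that by simp_all
    then have "H (f \<ominus>\<^bsub>?M\<^esub> g) = H f \<ominus>\<^bsub>C\<^esub> H g" by (simp add: M.minus_eq C.minus_eq del: monoid_ring_simps)
    then show ?thesis using that by (simp add: comm_monoid.monoid_ring_minus [OF comm_monoid_DirProd])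
  qed
  have H_of: "H (frag_of (a, b)) = \<alpha> a \<otimes>\<^bsub>C\<^esub> \<beta> b" if "a \<in> carrier A" "b \<in> carrier B" for a b
    using bspec [OF H(2), of "(a, b)"] that by simp
  \<comment> \<open>The shape that an additivity relation takes under \<open>H\<close> once the
    distributive laws have been applied.\<close>
  have cancel: "x \<oplus>\<^bsub>C\<^esub> y \<oplus>\<^bsub>C\<^esub> \<ominus>\<^bsub>C\<^esub> x \<oplus>\<^bsub>C\<^esub> \<ominus>\<^bsub>C\<^esub> y = \<zero>\<^bsub>C\<^esub>" if "x \<in> carrier C" "y \<in> carrier C" for x y
    using that C.r_neg [of "x \<oplus>\<^bsub>C\<^esub> y"] by (simp only: C.minus_add C.a_assoc C.add.m_closed C.a_inv_closed)
  have rel: "H x = \<zero>\<^bsub>C\<^esub>" if "x \<in> tensor_relations R A B" for x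
    using that unfolding tensor_relations_def
    by (elim UnE CollectE exE conjE)
      (simp_all add: H_diff H_of keys_diff_subsetI smult_closed_left smult_closed_right
        \<alpha>' \<beta>' C.l_distr C.r_distr cancel balanced C.minus_eq C.r_neg)
  have "tensor_ideal R A B \<subseteq> a_kernel ?M C H"
    unfolding tensor_ideal_def
  proof (rule M.genideal_minimal [OF H.kernel_is_ideal])
    show "tensor_relations R A B \<subseteq> a_kernel ?M C H"
      using tensor_relations_subset rel unfolding a_kernel_def' by blast
  qed
  then have "H x = \<zero>\<^bsub>C\<^esub>" if "x \<in> tensor_ideal R A B" for x
    using that unfolding a_kernel_def' by blast
  then obtain v where v: "v \<in> ring_hom (?M Quot tensor_ideal R A B) C"
    "\<forall>x\<in>carrier ?M. v (tensor_ideal R A B +>\<^bsub>?M\<^esub> x) = H x"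
    using quotient_lift [OF M.ring_axioms ideal_tensor C.ring_axioms H(1)] by blast
  have "v (pure_tensor R A B a b) = \<alpha> a \<otimes>\<^bsub>C\<^esub> \<beta> b" if "a \<in> carrier A" "b \<in> carrier B" for a b
    using bspec [OF v(2), of "frag_of (a, b)"] that by (simp add: pure_tensor_def H_of)
  then show ?thesis
    using v(1) by (intro bexI [of _ v]) (simp_all add: base_change_def)
qed

text \<open>Semilinearity of \<open>f\<close> and \<open>g\<close> over the same \<open>s\<close>
  turns the relation for a scalar \<open>r\<close> into the relation for \<open>s r\<close>. Hence
  the tensor ideal is preserved, and the union in the definition of \<open>tensor_endo\<close> runs
  over equal cosets.\<close>

lemma tensor_endo_hom:
  assumes f: "f \<in> ring_hom A A" and g: "g \<in> ring_hom B B"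
    and s: "\<And>r. r \<in> carrier R \<Longrightarrow> s r \<in> carrier R"
    and f_smult: "\<And>r a. \<lbrakk>r \<in> carrier R; a \<in> carrier A\<rbrakk> \<Longrightarrow> f (r \<odot>\<^bsub>A\<^esub> a) = s r \<odot>\<^bsub>A\<^esub> f a"
    and g_smult: "\<And>r b. \<lbrakk>r \<in> carrier R; b \<in> carrier B\<rbrakk> \<Longrightarrow> g (r \<odot>\<^bsub>B\<^esub> b) = s r \<odot>\<^bsub>B\<^esub> g b"
  shows "tensor_endo R A B f g \<in> ring_hom (base_change R A B) (base_change R A B)"
    and "\<lbrakk>a \<in> carrier A; b \<in> carrier B\<rbrakk> \<Longrightarrow>
      tensor_endo R A B f g (pure_tensor R A B a b) = pure_tensor R A B (f a) (g b)"
proof -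
  let ?M = "monoid_ring (A \<times>\<times> B)" and ?I = "tensor_ideal R A B"
  interpret M: cring ?M by (rule cring_generators)
  interpret I: ideal ?I ?M by (rule ideal_tensor)
  note f' = ring_hom_closed [OF f] ring_hom_add [OF f] ring_hom_mult [OF f] ring_hom_one [OF f]
  note g' = ring_hom_closed [OF g] ring_hom_add [OF g] ring_hom_mult [OF g] ring_hom_one [OF g]
  define F where "F = frag_extend (\<lambda>(a, b). frag_of (f a, g b))"
  have F: "F \<in> ring_hom ?M ?M"
  proof -
    have "frag_extend (\<lambda>x. frag_of (f (fst x), g (snd x))) \<in> ring_hom ?M ?M"
      by (rule comm_monoid.monoid_ring_endo [OF comm_monoid_DirProd]) (auto simp: f' g')
    then show ?thesis by (simp add: F_def case_prod_unfold)
  qed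
  interpret F: ring_hom_ring ?M ?M F by unfold_locales fact
  let ?q = "(+>\<^bsub>?M\<^esub>) ?I"
  have q: "?q \<in> ring_hom ?M (?M Quot ?I)" by (rule I.rcos_ring_hom)
  have "F x \<in> tensor_relations R A B" if "x \<in> tensor_relations R A B" for x
    using that unfolding tensor_relations_def
    apply (elim UnE CollectE exE conjE)
      apply (simp_all add: F_def frag_extend_diff f' g' f_smult g_smult)
      apply (metis f'(1) g'(1))
     apply (metis f'(1) g'(1))
    apply (metis f'(1) g'(1) s)
    done
  \<comment> \<open>The preimage of an ideal under a ring homomorphism is an ideal; containing the
    relations, it contains the ideal they generate.\<close>
  then have "tensor_relations R A B \<subseteq> {x \<in> carrier ?M. F x \<in> ?I}"
    using tensor_relations_subset tensor_relations_in_ideal by blast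
  then have "?I \<subseteq> {x \<in> carrier ?M. F x \<in> ?I}"
    unfolding tensor_ideal_def
    by (intro M.genideal_minimal) (use F.ideal_vimage [OF ideal_tensor] in \<open>simp_all add: tensor_ideal_def\<close>)
  then have FI: "F x \<in> ?I" if "x \<in> ?I" for x using that by blast
  have F_rcos: "?q (F x) = ?q (F y)" if x: "x \<in> ?q y" and y: "y \<in> carrier ?M" for x y
  proof -
    from x obtain i where i: "i \<in> ?I" "x = i \<oplus>\<^bsub>?M\<^esub> y" by (auto simp: a_r_coset_def' simp del: monoid_ring_simps)
    have "F x = F i \<oplus>\<^bsub>?M\<^esub> F y" using ring_hom_add [OF F I.a_Hcarr [OF i(1)] y] i(2) by simp
    then have "F x \<in> ?q (F y)" using FI [OF i(1)] by (auto simp: a_r_coset_def')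
    then show ?thesis
      using I.a_repr_independence' ring_hom_closed [OF F y] by metis
  qed
  have endo: "tensor_endo R A B f g (?q y) = ?q (F y)" if y: "y \<in> carrier ?M" for y
  proof -
    have "tensor_endo R A B f g (?q y) = (\<Union>x\<in>?q y. ?q (F x))"
      by (simp add: tensor_endo_def F_def)
    also have "\<dots> = (\<Union>x\<in>?q y. ?q (F y))"
      by (rule SUP_cong [OF refl]) (rule F_rcos [OF _ y])
    also have "\<dots> = ?q (F y)" using I.a_rcos_self [OF y] by blast
    finally show ?thesis .
  qed
  have "tensor_endo R A B f g \<in> ring_hom (?M Quot ?I) (?M Quot ?I)"
  proof (rule ring_hom_memI)
    fix x y assume "x \<in> carrier (?M Quot ?I)" "y \<in> carrier (?M Quot ?I)"
    then obtain a b where "a \<in> carrier ?M" "b \<in> carrier ?M" "x = ?q a" "y = ?q b"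
      by (auto simp: FactRing_def A_RCOSETS_def' simp del: monoid_ring_simps)
    then show "tensor_endo R A B f g (x \<otimes>\<^bsub>?M Quot ?I\<^esub> y)
        = tensor_endo R A B f g x \<otimes>\<^bsub>?M Quot ?I\<^esub> tensor_endo R A B f g y"
      and "tensor_endo R A B f g (x \<oplus>\<^bsub>?M Quot ?I\<^esub> y)
        = tensor_endo R A B f g x \<oplus>\<^bsub>?M Quot ?I\<^esub> tensor_endo R A B f g y"
      by (simp_all add: ring_hom_mult [OF q, symmetric] ring_hom_add [OF q, symmetric] endo
          del: monoid_ring_simps)
  next
    fix x assume "x \<in> carrier (?M Quot ?I)"
    then obtain a where "a \<in> carrier ?M" "x = ?q a"
      by (auto simp: FactRing_def A_RCOSETS_def' simp del: monoid_ring_simps)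
    then show "tensor_endo R A B f g x \<in> carrier (?M Quot ?I)"
      using ring_hom_closed [OF q] by (simp add: endo del: monoid_ring_simps)
  next
    show "tensor_endo R A B f g \<one>\<^bsub>?M Quot ?I\<^esub> = \<one>\<^bsub>?M Quot ?I\<^esub>"
      using endo [OF M.one_closed] ring_hom_one [OF q] by (simp del: monoid_ring_simps)
  qed
  then show "tensor_endo R A B f g \<in> ring_hom (base_change R A B) (base_change R A B)"
    by (simp add: base_change_def)
  show "tensor_endo R A B f g (pure_tensor R A B a b) = pure_tensor R A B (f a) (g b)"
    if "a \<in> carrier A" "b \<in> carrier B"
    using endo [of "frag_of (a, b)"] that by (simp add: pure_tensor_def F_def)
qed

end

section \<open>Direct limits along an endomorphism\<close>

lemma funpow_ring_hom: "f \<in> ring_hom A A \<Longrightarrow> f ^^ n \<in> ring_hom A A"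
proof (induction n)
  case 0
  show ?case by (auto intro: ring_hom_memI)
next
  case (Suc n)
  then show ?case using ring_hom_trans [of "f ^^ n" A A f A] by (simp only: funpow.simps)
qed

lemma funpow_funpow: "(f ^^ m) ((f ^^ n) x) = (f ^^ (m + n)) x"
  by (simp add: funpow_add)

locale cring_endo = cring N for N (structure) and \<Phi> +
  assumes endo: "\<Phi> \<in> ring_hom N N"
begin

abbreviation "cls \<equiv> dirlim_class N \<Phi>"
abbreviation "D \<equiv> dirlim_ring N \<Phi>"

lemmas funpow_endo = funpow_ring_hom [OF endo]

lemma funpow_closed [simp]: "a \<in> carrier N \<Longrightarrow> (\<Phi> ^^ n) a \<in> carrier N"
  by (rule ring_hom_closed [OF funpow_endo])

lemma endo_closed [simp]: "a \<in> carrier N \<Longrightarrow> \<Phi> a \<in> carrier N"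
  by (rule ring_hom_closed [OF endo])

text \<open>The reflexive closure also relates every pair outside
  \<open>carrier N \<times> {1..}\<close> to itself, so the equivalence lives on
  \<open>UNIV\<close>; that the classes of genuine elements stay inside is part of
  \<open>dirlim_rel_invariant\<close>.\<close>

lemma equiv_dirlim_rel: "equiv UNIV (dirlim_rel N \<Phi>)"
proof (rule equivI)
  show "sym (dirlim_rel N \<Phi>)"
    unfolding dirlim_rel_def Let_def by (intro sym_rtrancl sym_Un_converse)
qed (auto simp: dirlim_rel_def Let_def refl_on_def trans_rtrancl)

lemma dirlim_class_Suc:
  assumes "a \<in> carrier N" "1 \<le> i"
  shows "cls (\<Phi> a) (Suc i) = cls a i"
proof -
  have "((a, i), (\<Phi> a, Suc i)) \<in> dirlim_rel N \<Phi>"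
    unfolding dirlim_rel_def Let_def using assms by blast
  then show ?thesis
    unfolding dirlim_class_def by (rule equiv_class_eq [OF equiv_dirlim_rel, symmetric])
qed

lemma dirlim_class_shift:
  assumes "a \<in> carrier N" "1 \<le> i"
  shows "cls ((\<Phi> ^^ n) a) (i + n) = cls a i"
  using assms dirlim_class_Suc by (induction n) simp_all

section \<open>Equality of classes and the ring structure of the direct limit\<close>

text \<open>The familiar criterion that equivalent elements agree at some later stage. It survives a
  chain of generating steps because a forward step can be absorbed by raising \<open>m\<close> and a
  backward step by raising \<open>n\<close>.\<close>

lemma dirlim_rel_invariant:
  assumes "((a, i), y) \<in> dirlim_rel N \<Phi>" "a \<in> carrier N" "1 \<le> i"
  shows "fst y \<in> carrier N \<and> 1 \<le> snd y \<and>
    (\<exists>m n. i + m = snd y + n \<and> (\<Phi> ^^ m) a = (\<Phi> ^^ n) (fst y))"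
  using assms(1) unfolding dirlim_rel_def Let_def
proof (induction rule: rtrancl_induct)
  case base
  then show ?case using assms by (auto intro: exI [of _ 0])
next
  case (step y z)
  then obtain m n where mn: "i + m = snd y + n" "(\<Phi> ^^ m) a = (\<Phi> ^^ n) (fst y)" by blast
  from step(2) show ?case
  proof
    assume "(y, z) \<in> {((a, i), (\<Phi> a, Suc i)) |a i. a \<in> carrier N \<and> 1 \<le> i}"
    then have z: "z = (\<Phi> (fst y), Suc (snd y))" "fst y \<in> carrier N" by auto
    have "i + Suc m = snd z + n" "(\<Phi> ^^ Suc m) a = (\<Phi> ^^ n) (fst z)"
      using mn by (simp_all add: z funpow_swap1)
    moreover have "fst z \<in> carrier N" "1 \<le> snd z" using z by simp_all
    ultimately show ?thesis by blast
  next
    assume "(y, z) \<in> {((a, i), (\<Phi> a, Suc i)) |a i. a \<in> carrier N \<and> 1 \<le> i}\<inverse>"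
    then have y: "y = (\<Phi> (fst z), Suc (snd z))" "fst z \<in> carrier N" "1 \<le> snd z" by auto
    have "i + m = snd z + Suc n" "(\<Phi> ^^ m) a = (\<Phi> ^^ Suc n) (fst z)"
      using mn by (simp_all add: y funpow_swap1)
    then show ?thesis using y by blast
  qed
qed

lemma dirlim_class_eqI:
  assumes "a \<in> carrier N" "1 \<le> i" "b \<in> carrier N" "1 \<le> j"
    "i + m = j + n" "(\<Phi> ^^ m) a = (\<Phi> ^^ n) b"
  shows "cls a i = cls b j"
  using dirlim_class_shift [OF assms(1,2), of m] dirlim_class_shift [OF assms(3,4), of n] assms(5,6)
  by simp

lemma dirlim_class_memD:
  assumes "(b, j) \<in> cls a i" "a \<in> carrier N" "1 \<le> i"
  shows "b \<in> carrier N" "1 \<le> j" "\<exists>m n. i + m = j + n \<and> (\<Phi> ^^ m) a = (\<Phi> ^^ n) b"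
  using dirlim_rel_invariant [of a i "(b, j)"] assms by (simp_all add: dirlim_class_def)

lemma dirlim_class_self: "(a, i) \<in> cls a i"
  unfolding dirlim_class_def by (rule equiv_class_self [OF equiv_dirlim_rel]) simp

lemma carrier_dirlim: "carrier D = {cls a i | a i. a \<in> carrier N \<and> 1 \<le> i}"
  by (auto simp: dirlim_ring_def quotient_def dirlim_class_def)

lemma dirlim_class_closed [simp]: "\<lbrakk>a \<in> carrier N; 1 \<le> i\<rbrakk> \<Longrightarrow> cls a i \<in> carrier D"
  unfolding carrier_dirlim by blast

text \<open>Addition and multiplication are treated together, \<open>f\<close> standing for either.
  For two classes given at a common index, every choice of representatives in the defining unions
  yields the same class, since \<open>f\<close> commutes with the powers of
  \<open>\<Phi>\<close>.\<close>

lemma dirlim_op: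
  assumes closed: "\<And>a b. \<lbrakk>a \<in> carrier N; b \<in> carrier N\<rbrakk> \<Longrightarrow> f a b \<in> carrier N"
    and hom: "\<And>n a b. \<lbrakk>a \<in> carrier N; b \<in> carrier N\<rbrakk> \<Longrightarrow> (\<Phi> ^^ n) (f a b) = f ((\<Phi> ^^ n) a) ((\<Phi> ^^ n) b)"
    and ab: "a \<in> carrier N" "b \<in> carrier N" "1 \<le> i"
  shows "(\<Union>(a', i')\<in>cls a i. \<Union>(b', j')\<in>cls b i.
      cls (f ((\<Phi> ^^ j') a') ((\<Phi> ^^ i') b')) (i' + j')) = cls (f a b) i"
proof -
  have *: "cls (f ((\<Phi> ^^ j') a') ((\<Phi> ^^ i') b')) (i' + j') = cls (f a b) i"
    if a': "(a', i') \<in> cls a i" and b': "(b', j') \<in> cls b i" for a' i' b' j'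
  proof -
    note A = dirlim_class_memD [OF a' ab(1,3)] and B = dirlim_class_memD [OF b' ab(2,3)]
    obtain m n where mn: "i + m = i' + n" "(\<Phi> ^^ m) a = (\<Phi> ^^ n) a'" using A(3) by blast
    obtain q r where qr: "i + q = j' + r" "(\<Phi> ^^ q) b = (\<Phi> ^^ r) b'" using B(3) by blast
    \<comment> \<open>The stage for the comparison comes from adding the two index equations:
      \<open>i' + j' + (n + r) = i + (i + q + m)\<close>. Advancing by \<open>n + r\<close> on one
      side and by \<open>i + q + m\<close> on the other makes both arguments of \<open>f\<close>
      agree.\<close>
    have "(\<Phi> ^^ (n + r)) ((\<Phi> ^^ j') a') = (\<Phi> ^^ (r + j')) ((\<Phi> ^^ n) a')"
      by (simp only: funpow_funpow add_ac)
    also have "\<dots> = (\<Phi> ^^ (i + q + m)) a"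
      unfolding mn(2) [symmetric] funpow_funpow
      using qr(1) by (simp only: add_ac)
    finally have 1: "(\<Phi> ^^ (n + r)) ((\<Phi> ^^ j') a') = (\<Phi> ^^ (i + q + m)) a" .
    have "(\<Phi> ^^ (n + r)) ((\<Phi> ^^ i') b') = (\<Phi> ^^ (n + i')) ((\<Phi> ^^ r) b')"
      by (simp only: funpow_funpow add_ac)
    also have "\<dots> = (\<Phi> ^^ (i + m + q)) b"
      unfolding qr(2) [symmetric] funpow_funpow
      using mn(1) by (simp only: add_ac)
    finally have 2: "(\<Phi> ^^ (n + r)) ((\<Phi> ^^ i') b') = (\<Phi> ^^ (i + q + m)) b" by (simp only: add_ac)
    show ?thesis
    proof (rule dirlim_class_eqI [where m = "n + r" and n = "i + q + m"])
      show "(\<Phi> ^^ (n + r)) (f ((\<Phi> ^^ j') a') ((\<Phi> ^^ i') b')) = (\<Phi> ^^ (i + q + m)) (f a b)"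
        using A(1) B(1) ab by (simp only: hom 1 2 funpow_closed)
      show "i' + j' + (n + r) = i + (i + q + m)" using mn(1) qr(1) by linarith
    qed (use A B ab closed in auto)
  qed
  have inner: "(\<Union>(b', j')\<in>cls b i. cls (f ((\<Phi> ^^ j') a') ((\<Phi> ^^ i') b')) (i' + j')) = cls (f a b) i"
    if "(a', i') \<in> cls a i" for a' i'
  proof (rule SUP_eq_const)
    show "(case y of (b', j') \<Rightarrow> cls (f ((\<Phi> ^^ j') a') ((\<Phi> ^^ i') b')) (i' + j')) = cls (f a b) i"
      if "y \<in> cls b i" for y
      using * [OF \<open>(a', i') \<in> cls a i\<close>, of "fst y" "snd y"] that by (simp add: case_prod_unfold)
  qed (use dirlim_class_self in blast)
  show ?thesis
  proof (rule SUP_eq_const)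
    show "(case x of (a', i') \<Rightarrow> \<Union>(b', j')\<in>cls b i. cls (f ((\<Phi> ^^ j') a') ((\<Phi> ^^ i') b')) (i' + j'))
        = cls (f a b) i" if "x \<in> cls a i" for x
      using inner [of "fst x" "snd x"] that by (simp add: case_prod_unfold)
  qed (use dirlim_class_self in blast)
qed

lemma dirlim_class_add [simp]:
  assumes "a \<in> carrier N" "b \<in> carrier N" "1 \<le> i"
  shows "cls a i \<oplus>\<^bsub>D\<^esub> cls b i = cls (a \<oplus> b) i"
proof -
  have "cls a i \<oplus>\<^bsub>D\<^esub> cls b i
    = (\<Union>(a', i')\<in>cls a i. \<Union>(b', j')\<in>cls b i.
        cls ((\<Phi> ^^ j') a' \<oplus> (\<Phi> ^^ i') b') (i' + j'))"
    by (simp add: dirlim_ring_def)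
  also have "\<dots> = cls (a \<oplus> b) i"
    by (rule dirlim_op) (use assms in \<open>simp_all add: ring_hom_add [OF funpow_endo]\<close>)
  finally show ?thesis .
qed

lemma dirlim_class_mult [simp]:
  assumes "a \<in> carrier N" "b \<in> carrier N" "1 \<le> i"
  shows "cls a i \<otimes>\<^bsub>D\<^esub> cls b i = cls (a \<otimes> b) i"
proof -
  have "cls a i \<otimes>\<^bsub>D\<^esub> cls b i
    = (\<Union>(a', i')\<in>cls a i. \<Union>(b', j')\<in>cls b i.
        cls ((\<Phi> ^^ j') a' \<otimes> (\<Phi> ^^ i') b') (i' + j'))"
    by (simp add: dirlim_ring_def)
  also have "\<dots> = cls (a \<otimes> b) i"
    by (rule dirlim_op) (use assms in \<open>simp_all add: ring_hom_mult [OF funpow_endo]\<close>)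
  finally show ?thesis .
qed

text \<open>The constants are stored at index 1, while sums and products are evaluated at whatever
  index the operands share.\<close>

lemma dirlim_zero: "1 \<le> i \<Longrightarrow> \<zero>\<^bsub>D\<^esub> = cls \<zero> i"
  using dirlim_class_shift [of \<zero> 1 "i - 1"] ring_hom_zero [OF funpow_endo ring_axioms ring_axioms]
  by (simp add: dirlim_ring_def)

lemma dirlim_one: "1 \<le> i \<Longrightarrow> \<one>\<^bsub>D\<^esub> = cls \<one> i"
  using dirlim_class_shift [of \<one> 1 "i - 1"] ring_hom_one [OF funpow_endo]
  by (simp add: dirlim_ring_def)

text \<open>A representative at every sufficiently late index, not just at one, lets several
  elements be brought to a common index at once.\<close>

lemma dirlim_rep:
  assumes "x \<in> carrier D"
  shows "\<exists>i\<ge>1. \<forall>k\<ge>i. \<exists>a\<in>carrier N. x = cls a k"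
proof -
  from assms obtain a i where x: "x = cls a i" "a \<in> carrier N" "1 \<le> i"
    unfolding carrier_dirlim by blast
  have "\<exists>a\<in>carrier N. x = cls a k" if "i \<le> k" for k
    using x dirlim_class_shift [OF x(2,3), of "k - i"] that
    by (intro bexI [of _ "(\<Phi> ^^ (k - i)) a"]) simp_all
  with x(3) show ?thesis by blast
qed

lemma dirlim_rep3:
  assumes "x \<in> carrier D" "y \<in> carrier D" "z \<in> carrier D"
  obtains i a b c where "1 \<le> i" "a \<in> carrier N" "b \<in> carrier N" "c \<in> carrier N"
    "x = cls a i" "y = cls b i" "z = cls c i"
proof -
  obtain i where i: "1 \<le> i" "\<forall>k\<ge>i. \<exists>a\<in>carrier N. x = cls a k"
    using dirlim_rep [OF assms(1)] by blast
  obtain j where j: "\<forall>k\<ge>j. \<exists>a\<in>carrier N. y = cls a k"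
    using dirlim_rep [OF assms(2)] by blast
  obtain l where l: "\<forall>k\<ge>l. \<exists>a\<in>carrier N. z = cls a k"
    using dirlim_rep [OF assms(3)] by blast
  have "1 \<le> i + j + l" using i(1) by simp
  moreover obtain a b c where "a \<in> carrier N" "x = cls a (i + j + l)"
    "b \<in> carrier N" "y = cls b (i + j + l)" "c \<in> carrier N" "z = cls c (i + j + l)"
    using spec [OF i(2), of "i + j + l"] spec [OF j, of "i + j + l"] spec [OF l, of "i + j + l"] by auto
  ultimately show thesis by (intro that)
qed

lemma dirlim_rep2:
  assumes "x \<in> carrier D" "y \<in> carrier D"
  obtains i a b where "1 \<le> i" "a \<in> carrier N" "b \<in> carrier N" "x = cls a i" "y = cls b i"
  by (rule dirlim_rep3 [OF assms assms(2)]) (rule that)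

lemma cring_dirlim: "cring D"
proof (intro cringI abelian_groupI comm_monoidI)
  show "\<zero>\<^bsub>D\<^esub> \<in> carrier D" "\<one>\<^bsub>D\<^esub> \<in> carrier D"
    by (simp_all add: dirlim_zero [of 1] dirlim_one [of 1])
next
  fix x y assume "x \<in> carrier D" "y \<in> carrier D"
  then obtain i a b where *: "1 \<le> i" "a \<in> carrier N" "b \<in> carrier N" "x = cls a i" "y = cls b i"
    by (rule dirlim_rep2)
  then show "x \<oplus>\<^bsub>D\<^esub> y \<in> carrier D" "x \<otimes>\<^bsub>D\<^esub> y \<in> carrier D"
    "x \<oplus>\<^bsub>D\<^esub> y = y \<oplus>\<^bsub>D\<^esub> x" "x \<otimes>\<^bsub>D\<^esub> y = y \<otimes>\<^bsub>D\<^esub> x"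
    by (simp_all add: a_comm m_comm)
next
  fix x y z assume "x \<in> carrier D" "y \<in> carrier D" "z \<in> carrier D"
  then obtain i a b c where *: "1 \<le> i" "a \<in> carrier N" "b \<in> carrier N" "c \<in> carrier N"
    "x = cls a i" "y = cls b i" "z = cls c i"
    by (rule dirlim_rep3)
  then show "x \<oplus>\<^bsub>D\<^esub> y \<oplus>\<^bsub>D\<^esub> z = x \<oplus>\<^bsub>D\<^esub> (y \<oplus>\<^bsub>D\<^esub> z)"
    "x \<otimes>\<^bsub>D\<^esub> y \<otimes>\<^bsub>D\<^esub> z = x \<otimes>\<^bsub>D\<^esub> (y \<otimes>\<^bsub>D\<^esub> z)"
    "(x \<oplus>\<^bsub>D\<^esub> y) \<otimes>\<^bsub>D\<^esub> z = x \<otimes>\<^bsub>D\<^esub> z \<oplus>\<^bsub>D\<^esub> y \<otimes>\<^bsub>D\<^esub> z"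
    by (simp_all add: a_assoc m_assoc l_distr)
next
  fix x assume "x \<in> carrier D"
  then obtain i a where *: "1 \<le> i" "a \<in> carrier N" "x = cls a i"
    by (auto simp: carrier_dirlim)
  then show "\<zero>\<^bsub>D\<^esub> \<oplus>\<^bsub>D\<^esub> x = x" "\<one>\<^bsub>D\<^esub> \<otimes>\<^bsub>D\<^esub> x = x"
    by (simp_all add: dirlim_zero [of i] dirlim_one [of i])
  show "\<exists>y\<in>carrier D. y \<oplus>\<^bsub>D\<^esub> x = \<zero>\<^bsub>D\<^esub>"
    using * by (intro bexI [of _ "cls (\<ominus> a) i"]) (simp_all add: dirlim_zero [of i] l_neg)
qed

lemma dirlim_endo_class:
  assumes "a \<in> carrier N" "1 \<le> i"
  shows "dirlim_endo N \<Phi> (cls a i) = cls (\<Phi> a) i"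
proof -
  have "cls (\<Phi> b) j = cls (\<Phi> a) i" if b: "(b, j) \<in> cls a i" for b j
  proof -
    note B = dirlim_class_memD [OF b assms]
    obtain m n where mn: "i + m = j + n" "(\<Phi> ^^ m) a = (\<Phi> ^^ n) b" using B(3) by blast
    have "(\<Phi> ^^ n) (\<Phi> b) = (\<Phi> ^^ m) (\<Phi> a)"
      by (simp only: funpow_swap1 [symmetric] mn(2))
    then show ?thesis
      using mn(1) B assms by (intro dirlim_class_eqI [of _ _ _ _ n m]) simp_all
  qed
  then have "(case x of (b, j) \<Rightarrow> cls (\<Phi> b) j) = cls (\<Phi> a) i" if "x \<in> cls a i" for x
    using that by (cases x) simp
  moreover have "cls a i \<noteq> {}" using dirlim_class_self [of a i] by (metis empty_iff)
  ultimately show ?thesis unfolding dirlim_endo_def by (intro SUP_eq_const)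
qed

lemma dirlim_endo_hom: "dirlim_endo N \<Phi> \<in> ring_hom D D"
proof (rule ring_hom_memI)
  fix x assume "x \<in> carrier D"
  then obtain a i where "x = cls a i" "a \<in> carrier N" "1 \<le> i"
    unfolding carrier_dirlim by blast
  then show "dirlim_endo N \<Phi> x \<in> carrier D" by (simp add: dirlim_endo_class)
next
  fix x y assume "x \<in> carrier D" "y \<in> carrier D"
  then obtain i a b where *: "1 \<le> i" "a \<in> carrier N" "b \<in> carrier N" "x = cls a i" "y = cls b i"
    by (rule dirlim_rep2)
  then show "dirlim_endo N \<Phi> (x \<otimes>\<^bsub>D\<^esub> y) = dirlim_endo N \<Phi> x \<otimes>\<^bsub>D\<^esub> dirlim_endo N \<Phi> y"
    "dirlim_endo N \<Phi> (x \<oplus>\<^bsub>D\<^esub> y) = dirlim_endo N \<Phi> x \<oplus>\<^bsub>D\<^esub> dirlim_endo N \<Phi> y"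
    by (simp_all add: dirlim_endo_class ring_hom_mult [OF endo] ring_hom_add [OF endo])
next
  show "dirlim_endo N \<Phi> \<one>\<^bsub>D\<^esub> = \<one>\<^bsub>D\<^esub>"
    by (simp add: dirlim_one [of 1] dirlim_endo_class ring_hom_one [OF endo])
qed

lemma dirlim_class_hom: "(\<lambda>a. cls a 1) \<in> ring_hom N D"
  by (rule ring_hom_memI) (simp_all add: dirlim_one [of 1])

section \<open>The universal property of the direct limit\<close>

text \<open>The induced endomorphism lowers the index: it sends \<open>[a, k + 1]\<close> to
  \<open>[\<Phi> a, k + 1] = [a, k]\<close>. Injectivity of \<open>\<Psi>\<close> therefore carries
  agreement from index \<open>k\<close> to index \<open>k + 1\<close>.\<close>

lemma dirlim_ext:
  assumes inj: "inj_on \<Psi> S"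
    and w: "\<And>x. x \<in> carrier D \<Longrightarrow> w x \<in> S" "\<And>x. x \<in> carrier D \<Longrightarrow> \<Psi> (w x) = w (dirlim_endo N \<Phi> x)"
    and w': "\<And>x. x \<in> carrier D \<Longrightarrow> w' x \<in> S" "\<And>x. x \<in> carrier D \<Longrightarrow> \<Psi> (w' x) = w' (dirlim_endo N \<Phi> x)"
    and eq: "\<And>a. a \<in> carrier N \<Longrightarrow> w (cls a 1) = w' (cls a 1)"
    and x: "x \<in> carrier D"
  shows "w x = w' x"
proof -
  have "w (cls a (Suc k)) = w' (cls a (Suc k))" if "a \<in> carrier N" for a k
    using that
  proof (induction k arbitrary: a)
    case 0
    then show ?case using eq by simp
  next
    case (Suc k)
    let ?c = "cls a (Suc (Suc k))"
    have c: "?c \<in> carrier D" using Suc.prems by simp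
    have d: "dirlim_endo N \<Phi> ?c = cls a (Suc k)"
      using Suc.prems dirlim_class_Suc [of a "Suc k"] by (simp add: dirlim_endo_class)
    have "\<Psi> (w ?c) = \<Psi> (w' ?c)"
      by (simp only: w(2) [OF c] w'(2) [OF c] d Suc.IH [OF Suc.prems])
    then show ?case using inj_onD [OF inj] w(1) [OF c] w'(1) [OF c] by blast
  qed
  moreover obtain a i where "x = cls a i" "a \<in> carrier N" "1 \<le> i"
    using x unfolding carrier_dirlim by blast
  ultimately show ?thesis by (cases i) simp_all
qed

text \<open>Surjectivity of \<open>\<Psi> ^^ i\<close> provides a value at \<open>[a, i]\<close> and
  injectivity makes it unique; this uniqueness then gives the homomorphism laws and the
  compatibility with the endomorphisms.\<close>

lemma dirlim_lift:
  assumes C: "cring C" and \<Psi>: "\<Psi> \<in> ring_hom C C" "bij_betw \<Psi> (carrier C) (carrier C)"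
    and v: "v \<in> ring_hom N C" and comm: "\<And>a. a \<in> carrier N \<Longrightarrow> v (\<Phi> a) = \<Psi> (v a)"
  shows "\<exists>w\<in>ring_hom D C. (\<forall>a\<in>carrier N. w (cls a 1) = v a) \<and>
    (\<forall>x\<in>carrier D. \<Psi> (w x) = w (dirlim_endo N \<Phi> x))"
proof -
  interpret C: cring C by fact
  have bij: "bij_betw (\<Psi> ^^ n) (carrier C) (carrier C)" for n
    by (rule bij_betw_funpow [OF \<Psi>(2)])
  have inj: "c = d" if "(\<Psi> ^^ n) c = (\<Psi> ^^ n) d" "c \<in> carrier C" "d \<in> carrier C" for n c d
    using bij_betw_imp_inj_on [OF bij [of n]] that by (auto dest: inj_onD)
  note \<Psi>n = funpow_ring_hom [OF \<Psi>(1)]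
  have vc: "v a \<in> carrier C" if "a \<in> carrier N" for a
    using ring_hom_closed [OF v that] .
  have \<Psi>c: "\<Psi> c \<in> carrier C" if "c \<in> carrier C" for c
    using ring_hom_closed [OF \<Psi>(1) that] .
  have v_iter: "v ((\<Phi> ^^ n) a) = (\<Psi> ^^ n) (v a)" if "a \<in> carrier N" for n a
    using that by (induction n) (simp_all add: comm)
  \<comment> \<open>The equation says that \<open>c\<close> is \<open>\<Psi>\<close> to the power
    \<open>1 - i\<close> applied to \<open>v a\<close>, with negative powers cleared. The single
    \<open>\<Psi>\<close> on the right is there because the copies are numbered from 1.\<close>
  define w where
    "w x = (THE c. c \<in> carrier C \<and> (\<forall>(a, i)\<in>x. (\<Psi> ^^ i) c = \<Psi> (v a)))" for x
  have w: "w (cls a i) \<in> carrier C \<and> (\<Psi> ^^ i) (w (cls a i)) = \<Psi> (v a)"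
    if a: "a \<in> carrier N" and i: "1 \<le> i" for a i
  proof -
    have "\<Psi> (v a) \<in> (\<Psi> ^^ i) ` carrier C"
      using bij_betw_imp_surj_on [OF bij [of i]] \<Psi>c [OF vc [OF a]] by simp
    then obtain c where c: "c \<in> carrier C" "(\<Psi> ^^ i) c = \<Psi> (v a)" by auto
    \<comment> \<open>A solution found for one representative serves all of them: both sides are
      moved to the stage where the representatives agree, and \<open>\<Psi> ^^ n\<close> is
      cancelled there.\<close>
    have P: "(\<Psi> ^^ j) c = \<Psi> (v b)" if b: "(b, j) \<in> cls a i" for b j
    proof -
      note B = dirlim_class_memD [OF b a i]
      obtain m n where mn: "i + m = j + n" "(\<Phi> ^^ m) a = (\<Phi> ^^ n) b" using B(3) by blast
      have "(\<Psi> ^^ n) ((\<Psi> ^^ j) c) = (\<Psi> ^^ m) ((\<Psi> ^^ i) c)"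
        using mn(1) by (simp only: funpow_funpow add_ac)
      also have "\<dots> = \<Psi> (v ((\<Phi> ^^ m) a))"
        by (simp only: c(2) v_iter [OF a] funpow_swap1 [symmetric])
      also have "\<dots> = (\<Psi> ^^ n) (\<Psi> (v b))"
        by (simp only: mn(2) v_iter [OF B(1)] funpow_swap1 [symmetric])
      finally show ?thesis
        by (rule inj) (simp_all add: ring_hom_closed [OF \<Psi>n] c(1) \<Psi>c vc B(1))
    qed
    have "w (cls a i) = c"
      unfolding w_def
    proof (rule the_equality)
      show "c \<in> carrier C \<and> (\<forall>(a, i)\<in>cls a i. (\<Psi> ^^ i) c = \<Psi> (v a))" using c(1) P by blast
    next
      fix d assume d: "d \<in> carrier C \<and> (\<forall>(a, i)\<in>cls a i. (\<Psi> ^^ i) d = \<Psi> (v a))"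
      then have "(\<Psi> ^^ i) d = \<Psi> (v a)" using dirlim_class_self by blast
      then show "d = c" using inj [of i d c] d c by simp
    qed
    with c show ?thesis by simp
  qed
  have w_eqI: "w (cls a i) = c"
    if "a \<in> carrier N" "1 \<le> i" "c \<in> carrier C" "(\<Psi> ^^ i) c = \<Psi> (v a)" for a i c
    using w [OF that(1,2)] that(3,4) inj [of i "w (cls a i)" c] by simp
  have "w \<in> ring_hom D C"
  proof (rule ring_hom_memI)
    fix x assume "x \<in> carrier D"
    then show "w x \<in> carrier C" using w unfolding carrier_dirlim by blast
  next
    fix x y assume "x \<in> carrier D" "y \<in> carrier D"
    then obtain i a b where *: "1 \<le> i" "a \<in> carrier N" "b \<in> carrier N" "x = cls a i" "y = cls b i"
      by (rule dirlim_rep2)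
    note wa = w [OF *(2,1)] and wb = w [OF *(3,1)]
    have "w (cls (a \<otimes> b) i) = w (cls a i) \<otimes>\<^bsub>C\<^esub> w (cls b i)"
      by (rule w_eqI) (use * wa wb in \<open>simp_all add: ring_hom_mult [OF \<Psi>n] ring_hom_mult [OF \<Psi>(1)]
        ring_hom_mult [OF v] vc\<close>)
    then show "w (x \<otimes>\<^bsub>D\<^esub> y) = w x \<otimes>\<^bsub>C\<^esub> w y" using * by simp
    have "w (cls (a \<oplus> b) i) = w (cls a i) \<oplus>\<^bsub>C\<^esub> w (cls b i)"
      by (rule w_eqI) (use * wa wb in \<open>simp_all add: ring_hom_add [OF \<Psi>n] ring_hom_add [OF \<Psi>(1)]
        ring_hom_add [OF v] vc\<close>)
    then show "w (x \<oplus>\<^bsub>D\<^esub> y) = w x \<oplus>\<^bsub>C\<^esub> w y" using * by simp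
  next
    have "w (cls \<one> 1) = \<one>\<^bsub>C\<^esub>"
      by (rule w_eqI) (simp_all add: ring_hom_one [OF v])
    then show "w \<one>\<^bsub>D\<^esub> = \<one>\<^bsub>C\<^esub>" by (simp add: dirlim_one [of 1])
  qed
  moreover have "w (cls a 1) = v a" if "a \<in> carrier N" for a
    by (rule w_eqI) (use that in \<open>simp_all add: vc\<close>)
  moreover have "\<Psi> (w x) = w (dirlim_endo N \<Phi> x)" if "x \<in> carrier D" for x
  proof -
    from that obtain a i where x: "x = cls a i" "a \<in> carrier N" "1 \<le> i"
      unfolding carrier_dirlim by blast
    have "w (cls (\<Phi> a) i) = \<Psi> (w (cls a i))"
    proof (rule w_eqI)
      show "(\<Psi> ^^ i) (\<Psi> (w (cls a i))) = \<Psi> (v (\<Phi> a))"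
        using w [OF x(2,3)] by (simp only: funpow_swap1 [symmetric] comm [OF x(2)])
    qed (use x w [OF x(2,3)] \<Psi>c in simp_all)
    with x show ?thesis by (simp add: dirlim_endo_class)
  qed
  ultimately show ?thesis by blast
qed

end

section \<open>The \<open>p\<close>-adic completion\<close>

lemma (in ideal) rcos_add_eq:
  assumes "x \<in> carrier R" "x' \<in> carrier R" "y \<in> carrier R" "y' \<in> carrier R"
    "I +> x = I +> x'" "I +> y = I +> y'"
  shows "I +> (x \<oplus> y) = I +> (x' \<oplus> y')"
  using a_rcos_sum [of x y] a_rcos_sum [of x' y'] assms by simp

lemma (in ideal) rcos_mult_eq:
  assumes "x \<in> carrier R" "x' \<in> carrier R" "y \<in> carrier R" "y' \<in> carrier R"
    "I +> x = I +> x'" "I +> y = I +> y'"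
  shows "I +> (x \<otimes> y) = I +> (x' \<otimes> y')"
  using rcoset_mult_add [of x y] rcoset_mult_add [of x' y'] assms by simp

lemma (in ideal) rcos_mem:
  assumes "x \<in> I +> y" "y \<in> carrier R"
  shows "x \<in> carrier R" "I +> x = I +> y"
proof -
  show "x \<in> carrier R" using assms a_elemrcos_carrier by blast
  show "I +> x = I +> y" using a_repr_independence' [OF assms] by simp
qed

section \<open>Congruences modulo powers of p and elements of the completion\<close>

context cring
begin

abbreviation pelt :: "nat \<Rightarrow> 'a" where "pelt p \<equiv> add_pow R p \<one>"

lemma pelt_closed [simp]: "pelt p \<in> carrier R"
  by (rule add.nat_pow_closed) simp

lemma ideal_p_power: "ideal (p_power_ideal p R n) R"
  unfolding p_power_ideal_def by (rule cgenideal_ideal) simp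

lemma p_power_rcos_self: "a \<in> carrier R \<Longrightarrow> a \<in> p_power_ideal p R n +> a"
proof -
  interpret ideal "p_power_ideal p R n" R by (rule ideal_p_power)
  show "a \<in> carrier R \<Longrightarrow> a \<in> p_power_ideal p R n +> a" by (rule a_rcos_self)
qed

lemma p_power_ideal_iff: "x \<in> p_power_ideal p R n \<longleftrightarrow> (\<exists>s\<in>carrier R. x = s \<otimes> pelt p [^] n)"
  unfolding p_power_ideal_def cgenideal_def by blast

lemma p_power_ideal_antimono: "m \<le> n \<Longrightarrow> p_power_ideal p R n \<subseteq> p_power_ideal p R m"
proof
  fix x assume "m \<le> n" "x \<in> p_power_ideal p R n"
  then obtain s where s: "s \<in> carrier R" "x = s \<otimes> pelt p [^] n" by (auto simp: p_power_ideal_iff)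
  have "pelt p [^] n = pelt p [^] (n - m) \<otimes> pelt p [^] m"
    using \<open>m \<le> n\<close> by (simp add: nat_pow_mult)
  then have "x = (s \<otimes> pelt p [^] (n - m)) \<otimes> pelt p [^] m"
    using s by (simp add: m_assoc)
  then show "x \<in> p_power_ideal p R m"
    unfolding p_power_ideal_iff using s(1) by (intro bexI [of _ "s \<otimes> pelt p [^] (n - m)"]) simp_all
qed

lemma p_power_ideal_1: "p_power_ideal p R 1 = p_ideal p R"
  unfolding p_power_ideal_def by simp

lemma p_power_rcos_antimono:
  assumes "m \<le> n" "x \<in> carrier R" "y \<in> carrier R"
    "p_power_ideal p R n +> x = p_power_ideal p R n +> y"
  shows "p_power_ideal p R m +> x = p_power_ideal p R m +> y"
  by (rule ideal.rcos_eqI [OF ideal_p_power assms(2,3)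
      subsetD [OF p_power_ideal_antimono [OF assms(1)] ideal.rcos_eqD [OF ideal_p_power assms(2-4)]]])

text \<open>Since the ideals decrease, the finer coset of \<open>b (Suc n)\<close> lies in its
  coarser one, which by assumption is that of \<open>b n\<close>; congruences thus give the
  inclusions demanded of a compatible family.\<close>

lemma completion_mkI:
  assumes "\<And>n. b n \<in> carrier R" "\<And>n. p_power_ideal p R n +> b (Suc n) = p_power_ideal p R n +> b n"
  shows "(\<lambda>n. p_power_ideal p R n +> b n) \<in> carrier (padic_completion p R)"
proof -
  have "p_power_ideal p R n +> b n \<in> carrier (R Quot p_power_ideal p R n)" for n
    by (rule ring_hom_closed [OF ideal.rcos_ring_hom [OF ideal_p_power] assms(1)])
  moreover have "p_power_ideal p R (Suc n) +> b (Suc n) \<subseteq> p_power_ideal p R n +> b n" for n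
  proof -
    have "p_power_ideal p R (Suc n) +> b (Suc n) \<subseteq> p_power_ideal p R n +> b (Suc n)"
      using p_power_ideal_antimono [of n "Suc n" p] unfolding a_r_coset_def' by auto
    then show ?thesis by (simp only: assms(2))
  qed
  ultimately show ?thesis by (simp add: padic_completion_def)
qed

lemma completion_mem:
  assumes "x \<in> carrier (padic_completion p R)" "a \<in> x n"
  shows "a \<in> carrier R" "x n = p_power_ideal p R n +> a"
proof -
  have "x n \<in> carrier (R Quot p_power_ideal p R n)" using assms(1) by (simp add: padic_completion_def)
  then obtain c where c: "c \<in> carrier R" "x n = p_power_ideal p R n +> c"
    by (auto simp: FactRing_def A_RCOSETS_def')
  with assms(2) ideal.rcos_mem [OF ideal_p_power, of a p n c]
  show "a \<in> carrier R" "x n = p_power_ideal p R n +> a" by simp_all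
qed

lemma completion_antimono:
  assumes "x \<in> carrier (padic_completion p R)" "m \<le> n"
  shows "x n \<subseteq> x m"
proof -
  have "antimono x"
    using assms(1) by (intro decseq_SucI) (simp add: padic_completion_def)
  with assms(2) show ?thesis by (simp add: antimonoD)
qed

lemma completion_choice:
  assumes "x \<in> carrier (padic_completion p R)"
  shows "\<exists>b. \<forall>n. b n \<in> x n"
proof -
  have "\<exists>a. a \<in> x n" for n
  proof -
    have "x n \<in> carrier (R Quot p_power_ideal p R n)" using assms by (simp add: padic_completion_def)
    then obtain c where c: "c \<in> carrier R" "x n = p_power_ideal p R n +> c"
      by (auto simp: FactRing_def A_RCOSETS_def')
    then show ?thesis
      using p_power_rcos_self [of c p n] by blast
  qed
  then show ?thesis by metis
qed

lemma to_completion_closed [simp]: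
  "a \<in> carrier R \<Longrightarrow> to_completion p R a \<in> carrier (padic_completion p R)"
  unfolding to_completion_def by (rule completion_mkI) simp_all

lemma to_completion_mem: "a \<in> carrier R \<Longrightarrow> a \<in> to_completion p R a n"
  unfolding to_completion_def
  by (rule p_power_rcos_self)

lemma completion_mult_mem:
  assumes "x \<in> carrier (padic_completion p R)" "y \<in> carrier (padic_completion p R)" "a \<in> x n" "b \<in> y n"
  shows "(x \<otimes>\<^bsub>padic_completion p R\<^esub> y) n = p_power_ideal p R n +> (a \<otimes> b)"
  using completion_mem [OF assms(1,3)] completion_mem [OF assms(2,4)]
  by (simp add: padic_completion_def ring_hom_mult [OF ideal.rcos_ring_hom [OF ideal_p_power]])

lemma completion_add_mem:
  assumes "x \<in> carrier (padic_completion p R)" "y \<in> carrier (padic_completion p R)" "a \<in> x n" "b \<in> y n"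
  shows "(x \<oplus>\<^bsub>padic_completion p R\<^esub> y) n = p_power_ideal p R n +> (a \<oplus> b)"
  using completion_mem [OF assms(1,3)] completion_mem [OF assms(2,4)]
  by (simp add: padic_completion_def ring_hom_add [OF ideal.rcos_ring_hom [OF ideal_p_power]])

lemma completion_coherent:
  assumes "x \<in> carrier (padic_completion p R)" "\<And>n. b n \<in> x n" "n \<le> m"
  shows "p_power_ideal p R n +> b m = p_power_ideal p R n +> b n"
proof -
  have "b m \<in> x n" using completion_antimono [OF assms(1,3)] assms(2) by blast
  then show ?thesis
    using completion_mem(2) [OF assms(1)] assms(2) by metis
qed

lemma completion_op_closed:
  assumes x: "x \<in> carrier (padic_completion p R)" and y: "y \<in> carrier (padic_completion p R)"
  shows "x \<otimes>\<^bsub>padic_completion p R\<^esub> y \<in> carrier (padic_completion p R)"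
    and "x \<oplus>\<^bsub>padic_completion p R\<^esub> y \<in> carrier (padic_completion p R)"
proof -
  obtain a where a: "\<And>n. a n \<in> x n" using completion_choice [OF x] by blast
  obtain b where b: "\<And>n. b n \<in> y n" using completion_choice [OF y] by blast
  note ac = completion_mem(1) [OF x a] and bc = completion_mem(1) [OF y b]
  note ca = completion_coherent [OF x a, of n "Suc n" for n]
  note cb = completion_coherent [OF y b, of n "Suc n" for n]
  have "x \<otimes>\<^bsub>padic_completion p R\<^esub> y = (\<lambda>n. p_power_ideal p R n +> (a n \<otimes> b n))"
    using completion_mult_mem [OF x y a b] by blast
  moreover have "\<dots> \<in> carrier (padic_completion p R)"
    by (rule completion_mkI)
      (simp_all add: ac bc ca cb ideal.rcos_mult_eq [OF ideal_p_power])
  ultimately show "x \<otimes>\<^bsub>padic_completion p R\<^esub> y \<in> carrier (padic_completion p R)" by simp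
  have "x \<oplus>\<^bsub>padic_completion p R\<^esub> y = (\<lambda>n. p_power_ideal p R n +> (a n \<oplus> b n))"
    using completion_add_mem [OF x y a b] by blast
  moreover have "\<dots> \<in> carrier (padic_completion p R)"
    by (rule completion_mkI)
      (simp_all add: ac bc ca cb ideal.rcos_add_eq [OF ideal_p_power])
  ultimately show "x \<oplus>\<^bsub>padic_completion p R\<^esub> y \<in> carrier (padic_completion p R)" by simp
qed

lemma to_completion_hom: "to_completion p R \<in> ring_hom R (padic_completion p R)"
proof (rule ring_hom_memI)
  fix a b assume ab: "a \<in> carrier R" "b \<in> carrier R"
  show "to_completion p R (a \<otimes> b) = to_completion p R a \<otimes>\<^bsub>padic_completion p R\<^esub> to_completion p R b"
    using completion_mult_mem [OF to_completion_closed to_completion_closed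
        to_completion_mem to_completion_mem, OF ab(1) ab(2) ab(1) ab(2), of p]
    by (auto simp: to_completion_def [of p R "a \<otimes> b"])
  show "to_completion p R (a \<oplus> b) = to_completion p R a \<oplus>\<^bsub>padic_completion p R\<^esub> to_completion p R b"
    using completion_add_mem [OF to_completion_closed to_completion_closed
        to_completion_mem to_completion_mem, OF ab(1) ab(2) ab(1) ab(2), of p]
    by (auto simp: to_completion_def [of p R "a \<oplus> b"])
next
  show "to_completion p R \<one> = \<one>\<^bsub>padic_completion p R\<^esub>"
    by (simp add: padic_completion_def to_completion_def FactRing_def)
qed simp

text \<open>This is the injective half of completeness.\<close>

lemma padically_separated:
  assumes "padically_complete p R" "a \<in> carrier R" "b \<in> carrier R"
    "\<And>n. p_power_ideal p R n +> a = p_power_ideal p R n +> b"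
  shows "a = b"
proof -
  have "to_completion p R a = to_completion p R b"
    unfolding to_completion_def using assms(4) by blast
  then show ?thesis
    using assms(1-3) unfolding padically_complete_def bij_betw_def by (auto dest: inj_onD)
qed

text \<open>This is the surjective half of completeness: a compatible family is realised by one
  element.\<close>

lemma padically_complete_limit:
  assumes "padically_complete p R" "x \<in> carrier (padic_completion p R)"
  obtains a where "a \<in> carrier R" "\<And>n. x n = p_power_ideal p R n +> a"
proof -
  have "x \<in> to_completion p R ` carrier R"
    using assms unfolding padically_complete_def bij_betw_def by simp
  then show thesis using that unfolding to_completion_def by blast
qed

text \<open>The remainder \<open>x - b\<close>, \<open>b\<close> a representative modulo \<open>p\<^sup>n\<close>, is \<open>p\<^sup>n\<close> times the sum of the
  series formed from the increments of a sequence of representatives.\<close>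

lemma completion_decomposition:
  fixes n :: nat
  assumes x: "x \<in> carrier (padic_completion p R)"
  obtains b y where "b \<in> carrier R" "y \<in> carrier (padic_completion p R)"
    "x = to_completion p R b \<oplus>\<^bsub>padic_completion p R\<^esub>
      to_completion p R (pelt p [^] n) \<otimes>\<^bsub>padic_completion p R\<^esub> y"
proof -
  let ?I = "p_power_ideal p R"
  obtain b where b: "\<And>n. b n \<in> x n" using completion_choice [OF x] by blast
  have bc: "b m \<in> carrier R" for m by (rule completion_mem(1) [OF x b])
  have "\<exists>d\<in>carrier R. b (Suc m) \<ominus> b m = d \<otimes> pelt p [^] m" for m
    using ideal.rcos_eqD [OF ideal_p_power bc bc completion_coherent [OF x b, of m "Suc m"]]
    unfolding p_power_ideal_iff by simp
  then obtain d where d: "\<And>m. d m \<in> carrier R" "\<And>m. b (Suc m) \<ominus> b m = d m \<otimes> pelt p [^] m"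
    by metis
  \<comment> \<open>The increment of \<open>b\<close> from \<open>n + k\<close> to
    \<open>n + k + 1\<close> is \<open>d (n + k)\<close> times \<open>p^(n + k)\<close>. Building
    the sum from the recorded factors with \<open>p^k\<close> in place of \<open>p^(n + k)\<close>
    avoids a division by \<open>p^n\<close>, which torsion would make ambiguous.\<close>
  define s where "s = rec_nat \<zero> (\<lambda>k t. t \<oplus> d (n + k) \<otimes> pelt p [^] k)"
  have s0: "s 0 = \<zero>" and sS: "\<And>k. s (Suc k) = s k \<oplus> d (n + k) \<otimes> pelt p [^] k"
    by (simp_all add: s_def)
  have sc: "s k \<in> carrier R" for k
    by (induction k) (simp_all add: s0 sS d(1))
  have sum: "b n \<oplus> pelt p [^] n \<otimes> s k = b (n + k)" for k
  proof (induction k)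
    case 0
    then show ?case by (simp add: s0 bc)
  next
    case (Suc k)
    have "b n \<oplus> pelt p [^] n \<otimes> s (Suc k) = (b n \<oplus> pelt p [^] n \<otimes> s k) \<oplus> d (n + k) \<otimes> pelt p [^] (n + k)"
      unfolding sS nat_pow_mult [OF pelt_closed, symmetric]
      using sc d(1) bc by (simp add: r_distr a_assoc m_lcomm)
    also have "\<dots> = b (n + k) \<oplus> (b (Suc (n + k)) \<ominus> b (n + k))"
      by (simp only: Suc d(2))
    also have "\<dots> = b (n + Suc k)"
      using bc [of "n + k"] bc [of "Suc (n + k)"] by (simp add: minus_eq a_lcomm [of "b (n + k)" "b (Suc (n + k))"] r_neg)
    finally show ?case .
  qed
  define y where "y = (\<lambda>k. ?I k +> s k)"
  have y: "y \<in> carrier (padic_completion p R)"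
    unfolding y_def
  proof (rule completion_mkI)
    fix k
    have "s (Suc k) \<ominus> s k = d (n + k) \<otimes> pelt p [^] k"
      using sc [of k] d(1) [of "n + k"] by (simp add: sS minus_eq a_comm [of "s k"] a_assoc r_neg)
    then show "?I k +> s (Suc k) = ?I k +> s k"
      using d(1) by (intro ideal.rcos_eqI [OF ideal_p_power] sc) (auto simp: p_power_ideal_iff)
  qed (rule sc)
  have s_mem: "s k \<in> y k" for k
    unfolding y_def by (rule p_power_rcos_self [OF sc])
  let ?c = "to_completion p R (pelt p [^] n)"
  have c: "?c \<in> carrier (padic_completion p R)" by simp
  have prod: "(?c \<otimes>\<^bsub>padic_completion p R\<^esub> y) k = ?I k +> (pelt p [^] n \<otimes> s k)" for k
    by (rule completion_mult_mem [OF c y _ s_mem]) (rule to_completion_mem, simp)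
  then have prod_mem: "pelt p [^] n \<otimes> s k \<in> (?c \<otimes>\<^bsub>padic_completion p R\<^esub> y) k" for k
    using p_power_rcos_self [of "pelt p [^] n \<otimes> s k" p k] sc
    by simp
  have "x k = (to_completion p R (b n) \<oplus>\<^bsub>padic_completion p R\<^esub> ?c \<otimes>\<^bsub>padic_completion p R\<^esub> y) k" for k
  proof -
    have "(to_completion p R (b n) \<oplus>\<^bsub>padic_completion p R\<^esub> ?c \<otimes>\<^bsub>padic_completion p R\<^esub> y) k
        = ?I k +> (b n \<oplus> pelt p [^] n \<otimes> s k)"
      by (rule completion_add_mem [OF to_completion_closed [OF bc] completion_op_closed(1) [OF c y]
          to_completion_mem [OF bc] prod_mem])
    also have "\<dots> = ?I k +> b (n + k)" by (simp only: sum)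
    \<comment> \<open>Level \<open>k\<close> is met by the representative \<open>b (n + k)\<close>
      instead of \<open>b k\<close>; as \<open>k \<le> n + k\<close>, both lie in the same
      coset.\<close>
    also have "\<dots> = x k"
      using completion_mem(2) [OF x b, of k] completion_coherent [OF x b, of k "n + k"] by simp
    finally show ?thesis by simp
  qed
  then show thesis by (intro that [OF bc y] ext)
qed

end

section \<open>Ring homomorphisms and the p-adic topology\<close>

lemma ring_hom_pelt:
  fixes p n :: nat
  assumes "cring R" "cring S" "h \<in> ring_hom R S"
  shows "h (([p] \<cdot>\<^bsub>R\<^esub> \<one>\<^bsub>R\<^esub>) [^]\<^bsub>R\<^esub> (n :: nat)) = ([p] \<cdot>\<^bsub>S\<^esub> \<one>\<^bsub>S\<^esub>) [^]\<^bsub>S\<^esub> n"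
proof -
  interpret R: cring R by fact
  interpret S: cring S by fact
  interpret h: ring_hom_ring R S h by unfold_locales fact
  have "h ([k] \<cdot>\<^bsub>R\<^esub> \<one>\<^bsub>R\<^esub>) = [k] \<cdot>\<^bsub>S\<^esub> \<one>\<^bsub>S\<^esub>" for k :: nat
    by (induction k) (simp_all add: R.add.nat_pow_Suc S.add.nat_pow_Suc)
  then show ?thesis by (simp add: h.hom_nat_pow)
qed

text \<open>A homomorphism sends the image of \<open>p\<close> to the image of \<open>p\<close>,
  hence multiples of its powers to multiples of its powers; this is the source of all continuity
  below.\<close>

lemma ring_hom_p_power_ideal:
  assumes "cring R" "cring S" "h \<in> ring_hom R S" "x \<in> p_power_ideal p R n"
  shows "h x \<in> p_power_ideal p S n"
proof -
  interpret R: cring R by fact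
  interpret S: cring S by fact
  obtain s where "s \<in> carrier R" "x = s \<otimes>\<^bsub>R\<^esub> R.pelt p [^]\<^bsub>R\<^esub> n"
    using assms(4) R.p_power_ideal_iff by blast
  then have "h x = h s \<otimes>\<^bsub>S\<^esub> S.pelt p [^]\<^bsub>S\<^esub> n"
    using ring_hom_mult [OF assms(3)] ring_hom_pelt [OF assms(1-3)] by simp
  then show ?thesis
    using ring_hom_closed [OF assms(3) \<open>s \<in> carrier R\<close>] S.p_power_ideal_iff by blast
qed

lemma ring_hom_p_power_rcos:
  assumes RS: "cring R" "cring S" and h: "h \<in> ring_hom R S"
    and xy: "x \<in> carrier R" "y \<in> carrier R"
    and eq: "p_power_ideal p R n +>\<^bsub>R\<^esub> x = p_power_ideal p R n +>\<^bsub>R\<^esub> y"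
  shows "p_power_ideal p S n +>\<^bsub>S\<^esub> h x = p_power_ideal p S n +>\<^bsub>S\<^esub> h y"
proof -
  interpret R: cring R by fact
  interpret S: cring S by fact
  interpret h: ring_hom_ring R S h by unfold_locales fact
  have "h (x \<ominus>\<^bsub>R\<^esub> y) \<in> p_power_ideal p S n"
    by (rule ring_hom_p_power_ideal [OF RS h ideal.rcos_eqD [OF R.ideal_p_power xy eq]])
  then have "h x \<ominus>\<^bsub>S\<^esub> h y \<in> p_power_ideal p S n"
    using xy by (simp add: R.minus_eq S.minus_eq)
  then show ?thesis
    using xy by (intro ideal.rcos_eqI [OF S.ideal_p_power] h.hom_closed)
qed

text \<open>By continuity of \<open>f\<close> the union in \<open>completion_endo\<close> is taken
  over equal cosets, so any one representative evaluates it.\<close>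

lemma completion_endo_mem:
  assumes B: "cring B" and f: "f \<in> ring_hom B B"
    and x: "x \<in> carrier (padic_completion p B)" and b: "b \<in> x n"
  shows "completion_endo p B f x n = p_power_ideal p B n +>\<^bsub>B\<^esub> f b"
proof -
  interpret B: cring B by fact
  note bc = B.completion_mem [OF x b]
  show ?thesis
    unfolding completion_endo_def
  proof (rule SUP_eq_const)
    show "x n \<noteq> {}" using b by blast
    fix a assume a: "a \<in> x n"
    note ac = B.completion_mem [OF x a]
    have "p_power_ideal p B n +>\<^bsub>B\<^esub> a = p_power_ideal p B n +>\<^bsub>B\<^esub> b"
      using ac(2) bc(2) by simp
    then show "p_power_ideal p B n +>\<^bsub>B\<^esub> f a = p_power_ideal p B n +>\<^bsub>B\<^esub> f b"
      by (rule ring_hom_p_power_rcos [OF B B f ac(1) bc(1)])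
  qed
qed

lemma completion_endo_closed:
  assumes B: "cring B" and f: "f \<in> ring_hom B B" and x: "x \<in> carrier (padic_completion p B)"
  shows "completion_endo p B f x \<in> carrier (padic_completion p B)"
proof -
  interpret B: cring B by fact
  obtain b where b: "\<And>n. b n \<in> x n" using B.completion_choice [OF x] by blast
  note bc = B.completion_mem(1) [OF x b]
  have "completion_endo p B f x = (\<lambda>n. p_power_ideal p B n +>\<^bsub>B\<^esub> f (b n))"
    using completion_endo_mem [OF B f x b] by blast
  moreover have "\<dots> \<in> carrier (padic_completion p B)"
    using B.completion_coherent [OF x b, of n "Suc n" for n]
    by (intro B.completion_mkI ring_hom_closed [OF f] ring_hom_p_power_rcos [OF B B f] bc) simp_all
  ultimately show ?thesis by simp
qed

text \<open>Compatibility with endomorphisms is included because it follows from the description of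
  \<open>u x\<close> by its congruences, which the existential statement hides afterwards.\<close>

lemma completion_lift:
  assumes B: "cring B" and C: "cring C" "padically_complete p C" and w: "w \<in> ring_hom B C"
  shows "\<exists>u\<in>ring_hom (padic_completion p B) C. (\<forall>b\<in>carrier B. u (to_completion p B b) = w b) \<and>
    (\<forall>f \<Psi>. f \<in> ring_hom B B \<longrightarrow> \<Psi> \<in> ring_hom C C \<longrightarrow> (\<forall>b\<in>carrier B. \<Psi> (w b) = w (f b)) \<longrightarrow>
      (\<forall>x\<in>carrier (padic_completion p B). \<Psi> (u x) = u (completion_endo p B f x)))"
proof -
  interpret B: cring B by fact
  interpret C: cring C by fact
  let ?B = "padic_completion p B"
  let ?I = "p_power_ideal p B" and ?J = "p_power_ideal p C"
  have wc: "w b \<in> carrier C" if "b \<in> carrier B" for b using ring_hom_closed [OF w that] .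
  \<comment> \<open>\<open>u x\<close> is the limit of \<open>w b\<close> along representatives
    \<open>b\<close> of \<open>x\<close>. Requiring the congruence for every representative makes
    the description free of choices.\<close>
  define u where "u x = (THE c. c \<in> carrier C \<and> (\<forall>n. \<forall>b\<in>x n. ?J n +>\<^bsub>C\<^esub> c = ?J n +>\<^bsub>C\<^esub> w b))" for x
  have cong: "?J n +>\<^bsub>C\<^esub> w b = ?J n +>\<^bsub>C\<^esub> w b'" if x: "x \<in> carrier ?B" and b: "b \<in> x n" "b' \<in> x n" for x b b' n
    using B.completion_mem [OF x b(1)] B.completion_mem [OF x b(2)]
    by (intro ring_hom_p_power_rcos [OF B C(1) w]) simp_all
  \<comment> \<open>One representative per level is enough to recognise the value, since
    \<open>cong\<close> passes the congruence on to the others; two candidates coincide because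
    \<open>C\<close> is separated.\<close>
  have uniq: "u x = c" if x: "x \<in> carrier ?B" and c: "c \<in> carrier C"
    and eq: "\<And>n. \<exists>b\<in>x n. ?J n +>\<^bsub>C\<^esub> c = ?J n +>\<^bsub>C\<^esub> w b" for x c
    unfolding u_def
  proof (rule the_equality)
    show "c \<in> carrier C \<and> (\<forall>n. \<forall>b\<in>x n. ?J n +>\<^bsub>C\<^esub> c = ?J n +>\<^bsub>C\<^esub> w b)"
      using c eq cong [OF x] by metis
    fix c' assume c': "c' \<in> carrier C \<and> (\<forall>n. \<forall>b\<in>x n. ?J n +>\<^bsub>C\<^esub> c' = ?J n +>\<^bsub>C\<^esub> w b)"
    then have "?J n +>\<^bsub>C\<^esub> c' = ?J n +>\<^bsub>C\<^esub> c" for n using eq [of n] by metis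
    then show "c' = c" using C.padically_separated [OF C(2)] c c' by blast
  qed
  have ex: "\<exists>c\<in>carrier C. \<forall>n. \<exists>b\<in>x n. ?J n +>\<^bsub>C\<^esub> c = ?J n +>\<^bsub>C\<^esub> w b" if x: "x \<in> carrier ?B" for x
  proof -
    obtain b where b: "\<And>n. b n \<in> x n" using B.completion_choice [OF x] by blast
    note bc = B.completion_mem(1) [OF x b]
    have "(\<lambda>n. ?J n +>\<^bsub>C\<^esub> w (b n)) \<in> carrier (padic_completion p C)"
      using B.completion_coherent [OF x b, of n "Suc n" for n]
      by (intro C.completion_mkI wc ring_hom_p_power_rcos [OF B C(1) w] bc) simp_all
    then obtain c where c: "c \<in> carrier C" "\<And>n. ?J n +>\<^bsub>C\<^esub> w (b n) = ?J n +>\<^bsub>C\<^esub> c"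
      by (rule C.padically_complete_limit [OF C(2)]) blast
    then show ?thesis using b by metis
  qed
  have u: "u x \<in> carrier C" "\<And>n b. b \<in> x n \<Longrightarrow> ?J n +>\<^bsub>C\<^esub> u x = ?J n +>\<^bsub>C\<^esub> w b"
    if x: "x \<in> carrier ?B" for x
  proof -
    obtain c where c: "c \<in> carrier C" "\<forall>n. \<exists>b\<in>x n. ?J n +>\<^bsub>C\<^esub> c = ?J n +>\<^bsub>C\<^esub> w b"
      using ex [OF x] by blast
    then have ux: "u x = c" by (intro uniq [OF x]) blast+
    with c(1) show "u x \<in> carrier C" by simp
    fix n b assume b: "b \<in> x n"
    obtain b' where "b' \<in> x n" "?J n +>\<^bsub>C\<^esub> c = ?J n +>\<^bsub>C\<^esub> w b'" using c(2) by blast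
    with cong [OF x b] ux show "?J n +>\<^bsub>C\<^esub> u x = ?J n +>\<^bsub>C\<^esub> w b" by simp
  qed
  have to: "u (to_completion p B b) = w b" if b: "b \<in> carrier B" for b
    by (rule uniq [OF B.to_completion_closed [OF b] wc [OF b]]) (use B.to_completion_mem [OF b] in blast)
  have "u \<in> ring_hom ?B C"
  proof (rule ring_hom_memI)
    fix x assume "x \<in> carrier ?B" then show "u x \<in> carrier C" by (rule u(1))
  next
    fix x y assume x: "x \<in> carrier ?B" and y: "y \<in> carrier ?B"
    obtain a where a: "\<And>n. a n \<in> x n" using B.completion_choice [OF x] by blast
    obtain b where b: "\<And>n. b n \<in> y n" using B.completion_choice [OF y] by blast
    have ac: "a n \<in> carrier B" for n by (rule B.completion_mem(1) [OF x a])
    have bc: "b n \<in> carrier B" for n by (rule B.completion_mem(1) [OF y b])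
    show "u (x \<otimes>\<^bsub>?B\<^esub> y) = u x \<otimes>\<^bsub>C\<^esub> u y"
    proof (rule uniq [OF B.completion_op_closed(1) [OF x y]])
      show "u x \<otimes>\<^bsub>C\<^esub> u y \<in> carrier C" using u(1) x y by simp
      fix n
      have "?J n +>\<^bsub>C\<^esub> (u x \<otimes>\<^bsub>C\<^esub> u y) = ?J n +>\<^bsub>C\<^esub> (w (a n) \<otimes>\<^bsub>C\<^esub> w (b n))"
        by (intro ideal.rcos_mult_eq [OF C.ideal_p_power] u x y wc ac bc a b)
      moreover have "a n \<otimes>\<^bsub>B\<^esub> b n \<in> (x \<otimes>\<^bsub>?B\<^esub> y) n"
        unfolding B.completion_mult_mem [OF x y a b] by (rule B.p_power_rcos_self) (simp add: ac bc)
      ultimately show "\<exists>b\<in>(x \<otimes>\<^bsub>?B\<^esub> y) n. ?J n +>\<^bsub>C\<^esub> (u x \<otimes>\<^bsub>C\<^esub> u y) = ?J n +>\<^bsub>C\<^esub> w b"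
        by (intro bexI [of _ "a n \<otimes>\<^bsub>B\<^esub> b n"]) (simp_all add: ring_hom_mult [OF w] ac bc)
    qed
    show "u (x \<oplus>\<^bsub>?B\<^esub> y) = u x \<oplus>\<^bsub>C\<^esub> u y"
    proof (rule uniq [OF B.completion_op_closed(2) [OF x y]])
      show "u x \<oplus>\<^bsub>C\<^esub> u y \<in> carrier C" using u(1) x y by simp
      fix n
      have "?J n +>\<^bsub>C\<^esub> (u x \<oplus>\<^bsub>C\<^esub> u y) = ?J n +>\<^bsub>C\<^esub> (w (a n) \<oplus>\<^bsub>C\<^esub> w (b n))"
        by (intro ideal.rcos_add_eq [OF C.ideal_p_power] u x y wc ac bc a b)
      moreover have "a n \<oplus>\<^bsub>B\<^esub> b n \<in> (x \<oplus>\<^bsub>?B\<^esub> y) n"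
        unfolding B.completion_add_mem [OF x y a b] by (rule B.p_power_rcos_self) (simp add: ac bc)
      ultimately show "\<exists>b\<in>(x \<oplus>\<^bsub>?B\<^esub> y) n. ?J n +>\<^bsub>C\<^esub> (u x \<oplus>\<^bsub>C\<^esub> u y) = ?J n +>\<^bsub>C\<^esub> w b"
        by (intro bexI [of _ "a n \<oplus>\<^bsub>B\<^esub> b n"]) (simp_all add: ring_hom_add [OF w] ac bc)
    qed
  next
    show "u \<one>\<^bsub>?B\<^esub> = \<one>\<^bsub>C\<^esub>"
      using to [OF B.one_closed] ring_hom_one [OF w] ring_hom_one [OF B.to_completion_hom, of p] by simp
  qed
  moreover have "\<Psi> (u x) = u (completion_endo p B f x)"
    if f: "f \<in> ring_hom B B" and \<Psi>: "\<Psi> \<in> ring_hom C C"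
      and comm: "\<forall>b\<in>carrier B. \<Psi> (w b) = w (f b)" and x: "x \<in> carrier ?B" for f \<Psi> x
  proof (rule uniq [symmetric])
    show "completion_endo p B f x \<in> carrier ?B" by (rule completion_endo_closed [OF B f x])
    show "\<Psi> (u x) \<in> carrier C" by (rule ring_hom_closed [OF \<Psi> u(1) [OF x]])
    fix n
    obtain b where b: "b \<in> x n" using B.completion_choice [OF x] by blast
    note bc = B.completion_mem(1) [OF x b]
    have "?J n +>\<^bsub>C\<^esub> \<Psi> (u x) = ?J n +>\<^bsub>C\<^esub> \<Psi> (w b)"
      by (rule ring_hom_p_power_rcos [OF C(1) C(1) \<Psi> u(1) [OF x] wc [OF bc] u(2) [OF x b]])
    moreover have "f b \<in> completion_endo p B f x n"
      unfolding completion_endo_mem [OF B f x b]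
      by (rule B.p_power_rcos_self [OF ring_hom_closed [OF f bc]])
    ultimately show "\<exists>b\<in>completion_endo p B f x n. ?J n +>\<^bsub>C\<^esub> \<Psi> (u x) = ?J n +>\<^bsub>C\<^esub> w b"
      using comm bc by (intro bexI [of _ "f b"]) simp_all
  qed
  ultimately show ?thesis using to by (intro bexI [of _ u]) blast+
qed

text \<open>By \<open>completion_decomposition\<close> an element is a constant from
  \<open>B\<close> plus \<open>p^n\<close> times an element of the completion, so modulo
  \<open>p^n\<close> a homomorphism sees only the constant. Agreement on \<open>B\<close> thus gives
  agreement modulo every \<open>p^n\<close>, and \<open>C\<close> is separated.\<close>

lemma completion_hom_ext:
  assumes B: "cring B" and C: "cring C" "padically_complete p C"
    and u: "u \<in> ring_hom (padic_completion p B) C" "u' \<in> ring_hom (padic_completion p B) C"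
    and eq: "\<And>b. b \<in> carrier B \<Longrightarrow> u (to_completion p B b) = u' (to_completion p B b)"
    and x: "x \<in> carrier (padic_completion p B)"
  shows "u x = u' x"
proof (rule cring.padically_separated [OF C])
  interpret B: cring B by fact
  interpret C: cring C by fact
  show "u x \<in> carrier C" "u' x \<in> carrier C"
    using ring_hom_closed [OF u(1) x] ring_hom_closed [OF u(2) x] .
  fix n :: nat
  obtain b y where b: "b \<in> carrier B" and y: "y \<in> carrier (padic_completion p B)"
    and x: "x = to_completion p B b \<oplus>\<^bsub>padic_completion p B\<^esub>
      to_completion p B (B.pelt p [^]\<^bsub>B\<^esub> n) \<otimes>\<^bsub>padic_completion p B\<^esub> y"
    by (rule B.completion_decomposition [OF x, of n])
  have *: "p_power_ideal p C n +>\<^bsub>C\<^esub> h x = p_power_ideal p C n +>\<^bsub>C\<^esub> h (to_completion p B b)"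
    if h: "h \<in> ring_hom (padic_completion p B) C" for h
  proof -
    have "h (to_completion p B (B.pelt p [^]\<^bsub>B\<^esub> n)) = C.pelt p [^]\<^bsub>C\<^esub> n"
      using ring_hom_pelt [OF B C(1) ring_hom_trans [OF B.to_completion_hom h]] by simp
    then have "h x = h (to_completion p B b) \<oplus>\<^bsub>C\<^esub> C.pelt p [^]\<^bsub>C\<^esub> n \<otimes>\<^bsub>C\<^esub> h y"
      unfolding x using b y
      by (simp add: ring_hom_add [OF h] ring_hom_mult [OF h] B.completion_op_closed)
    moreover have hc: "h (to_completion p B b) \<in> carrier C" "h y \<in> carrier C"
      using ring_hom_closed [OF h] b y by simp_all
    ultimately have "h x \<ominus>\<^bsub>C\<^esub> h (to_completion p B b) = h y \<otimes>\<^bsub>C\<^esub> C.pelt p [^]\<^bsub>C\<^esub> n"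
      by (simp add: C.minus_eq C.a_comm [of "h (to_completion p B b)"] C.a_assoc C.r_neg C.m_comm)
    then have "h x \<ominus>\<^bsub>C\<^esub> h (to_completion p B b) \<in> p_power_ideal p C n"
      using hc C.p_power_ideal_iff by blast
    moreover have "h x \<in> carrier C" using ring_hom_closed [OF h assms(7)] .
    ultimately show ?thesis using hc by (intro ideal.rcos_eqI [OF C.ideal_p_power])
  qed
  show "p_power_ideal p C n +>\<^bsub>C\<^esub> u x = p_power_ideal p C n +>\<^bsub>C\<^esub> u' x"
    unfolding * [OF u(1)] * [OF u(2)] eq [OF b] ..
qed

section \<open>Frobenius lifts and the universal property\<close>

text \<open>The polynomial \<open>X^n - a\<close> splits, so its multiset of roots has size
  \<open>n > 0\<close>.\<close>

lemma (in algebraically_closed) nth_root_exists: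
  assumes a: "a \<in> carrier L" and n: "n > 0"
  shows "\<exists>x\<in>carrier L. x [^] (n :: nat) = a"
proof -
  \<comment> \<open>Coefficient lists start with the leading term, so appending a constant term
    multiplies by \<open>X\<close> first; this raises \<open>X^(n - 1)\<close> to
    \<open>X^n\<close>.\<close>
  define P where "P = monom \<one> (n - 1) @ [\<ominus> a]"
  have "polynomial (carrier L) P"
    using a monom_in_carrier [OF one_closed, of "n - 1"] unfolding polynomial_def P_def
    by (simp add: monom_def)
  then have P: "P \<in> carrier (poly_ring L)" by (simp add: univ_poly_carrier)
  have "size (roots P) = n"
    using roots_over_carrier [OF P] n unfolding splitted_def P_def by (simp add: monom_def)
  then have "roots P \<noteq> {#}" using n by auto
  then obtain x where "x \<in># roots P" by blast
  then have x: "x \<in> carrier L" "eval P x = \<zero>"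
    using roots_mem_iff_is_root [OF P] unfolding is_root_def by auto
  have "eval P x = x [^] (n - 1) \<otimes> x \<oplus> \<ominus> a"
    unfolding P_def using a x(1) monom_in_carrier [OF one_closed, of "n - 1"]
    by (subst eval_append_aux) (simp_all add: eval_monom)
  also have "x [^] (n - 1) \<otimes> x = x [^] n" using n nat_pow_Suc [of x "n - 1"] by simp
  finally have "x [^] n \<ominus> a = \<zero>" using x(2) by (simp add: minus_eq)
  then have "x [^] n = a" using x(1) a by (simp add: r_right_minus_eq)
  with x(1) show ?thesis by blast
qed

context cring
begin

text \<open>The residue class of \<open>r\<close> has a \<open>p\<close>-th root in the
  algebraically closed residue field. Its lift \<open>x\<close> satisfies \<open>x^p = r\<close>
  modulo \<open>p\<close>, and \<open>y\<close> records the difference.\<close>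

lemma pth_power_decomposition:
  assumes "algebraically_closed (R Quot p_ideal p R)" "p > 0" and r: "r \<in> carrier R"
  obtains x y where "x \<in> carrier R" "y \<in> carrier R" "r = x [^] p \<oplus> pelt p \<otimes> y"
proof -
  interpret I: ideal "p_ideal p R" R by (rule cgenideal_ideal) simp
  let ?q = "(+>) (p_ideal p R)"
  interpret q: ring_hom_ring R "R Quot p_ideal p R" ?q by (rule I.rcos_ring_hom_ring)
  obtain X' where X': "X' \<in> carrier (R Quot p_ideal p R)" "X' [^]\<^bsub>R Quot p_ideal p R\<^esub> p = ?q r"
    using algebraically_closed.nth_root_exists [OF assms(1) q.hom_closed [OF r] assms(2)] by blast
  obtain x where x: "x \<in> carrier R" "X' = ?q x"
  proof -
    have "X' \<in> (\<Union>a\<in>carrier R. {?q a})"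
      using X'(1) unfolding FactRing_def A_RCOSETS_def' by (simp only: partial_object.simps)
    then show thesis using that by blast
  qed
  have "?q r = ?q (x [^] p)" using X'(2) x by (simp add: q.hom_nat_pow)
  then have "r \<ominus> x [^] p \<in> p_ideal p R" using x(1) r by (intro I.rcos_eqD) simp_all
  then obtain y where y: "y \<in> carrier R" "r \<ominus> x [^] p = y \<otimes> pelt p"
    unfolding cgenideal_def by blast
  have "x [^] p \<oplus> (r \<ominus> x [^] p) = r"
    using x(1) r by (simp add: minus_eq a_lcomm [of "x [^] p" r] r_neg)
  then have "r = x [^] p \<oplus> pelt p \<otimes> y" unfolding y(2) using y(1) by (simp add: m_comm)
  with x(1) y(1) show thesis by (rule that)
qed

text \<open>The binomial theorem up to second order in \<open>e\<close>. Only the divisibility of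
  the remainder by \<open>e \<otimes> e\<close> matters later, so its cofactor stays existential and
  no binomial coefficients appear.\<close>

lemma power_add_expansion:
  assumes b: "b \<in> carrier R" and e: "e \<in> carrier R"
  shows "\<exists>z\<in>carrier R. (b \<oplus> e) [^] Suc k = b [^] Suc k \<oplus> pelt (Suc k) \<otimes> e \<otimes> b [^] k \<oplus> e \<otimes> e \<otimes> z"
proof (induction k)
  case 0
  show ?case using b e by (intro bexI [of _ \<zero>]) simp_all
next
  case (Suc k)
  then obtain z where z: "z \<in> carrier R"
    "(b \<oplus> e) [^] Suc k = b [^] Suc k \<oplus> pelt (Suc k) \<otimes> e \<otimes> b [^] k \<oplus> e \<otimes> e \<otimes> z" by blast
  \<comment> \<open>Naming the power and the integer multiple leaves a polynomial identity in plain
    variables for \<open>algebra\<close>.\<close>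
  define B q where "B = b [^] k" and "q = pelt (Suc k)"
  have B: "B \<in> carrier R" and q: "q \<in> carrier R" using b by (simp_all add: B_def q_def del: add.nat_pow_Suc)
  have q': "pelt (Suc (Suc k)) = q \<oplus> \<one>" unfolding q_def by (rule add.nat_pow_Suc)
  have "(b \<oplus> e) [^] Suc (Suc k) = (B \<otimes> b \<oplus> q \<otimes> e \<otimes> B \<oplus> e \<otimes> e \<otimes> z) \<otimes> (b \<oplus> e)"
    using z(2) by (simp only: nat_pow_Suc [of _ "Suc k"] B_def q_def nat_pow_Suc [of b k])
  also have "\<dots> = B \<otimes> b \<otimes> b \<oplus> (q \<oplus> \<one>) \<otimes> e \<otimes> (B \<otimes> b) \<oplus> e \<otimes> e \<otimes> (q \<otimes> B \<oplus> z \<otimes> b \<oplus> z \<otimes> e)"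
    using b e z(1) B q by algebra
  finally have "(b \<oplus> e) [^] Suc (Suc k) = b [^] Suc (Suc k) \<oplus> pelt (Suc (Suc k)) \<otimes> e \<otimes> b [^] Suc k
      \<oplus> e \<otimes> e \<otimes> (q \<otimes> B \<oplus> z \<otimes> b \<oplus> z \<otimes> e)"
    by (simp only: q' B_def nat_pow_Suc)
  moreover have "q \<otimes> B \<oplus> z \<otimes> b \<oplus> z \<otimes> e \<in> carrier R" using b e z(1) B q by simp
  ultimately show ?case by blast
qed

text \<open>For \<open>a = b + e\<close> with \<open>e\<close> divisible by
  \<open>p^(m + 1)\<close>, the linear term carries an extra factor \<open>p\<close>, and
  \<open>e \<otimes> e\<close> is divisible by \<open>p^(2m + 2)\<close>, hence by
  \<open>p^(m + 2)\<close>. The exponent starts at 1 because the second point fails for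
  \<open>p^0\<close>.\<close>

lemma pth_power_rcos:
  assumes a: "a \<in> carrier R" and b: "b \<in> carrier R" and "p > 0"
    and eq: "p_power_ideal p R (Suc m) +> a = p_power_ideal p R (Suc m) +> b"
  shows "p_power_ideal p R (Suc (Suc m)) +> a [^] p = p_power_ideal p R (Suc (Suc m)) +> b [^] p"
proof -
  define P Q where "P = pelt p" and "Q = P [^] m"
  have P: "P \<in> carrier R" and Q: "Q \<in> carrier R" by (simp_all add: P_def Q_def)
  have "a \<ominus> b \<in> p_power_ideal p R (Suc m)" by (rule ideal.rcos_eqD [OF ideal_p_power a b eq])
  then obtain s where s: "s \<in> carrier R" "a \<ominus> b = s \<otimes> (Q \<otimes> P)"
    by (auto simp: p_power_ideal_iff P_def Q_def)
  define e where "e = s \<otimes> (Q \<otimes> P)"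
  have e: "e \<in> carrier R" using s(1) P Q by (simp add: e_def)
  have ab: "a = b \<oplus> e"
    using a b unfolding e_def s(2) [symmetric] by (simp add: minus_eq a_lcomm [of b a] r_neg)
  obtain k where k: "p = Suc k" using \<open>p > 0\<close> gr0_conv_Suc by blast
  obtain z where z: "z \<in> carrier R" "a [^] p = b [^] p \<oplus> P \<otimes> e \<otimes> b [^] k \<oplus> e \<otimes> e \<otimes> z"
    using power_add_expansion [OF b e, of k] unfolding ab P_def k by blast
  define B D' where "B = b [^] k" and "D' = b [^] p"
  have B: "B \<in> carrier R" and D': "D' \<in> carrier R" using b by (simp_all add: B_def D'_def)
  have "a [^] p \<ominus> b [^] p = D' \<oplus> P \<otimes> e \<otimes> B \<oplus> e \<otimes> e \<otimes> z \<oplus> \<ominus> D'"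
    unfolding z(2) by (simp add: minus_eq B_def D'_def)
  also have "\<dots> = (s \<otimes> B \<oplus> s \<otimes> s \<otimes> z \<otimes> Q) \<otimes> (Q \<otimes> P \<otimes> P)"
    unfolding e_def using P Q s(1) z(1) B D' by algebra
  also have "Q \<otimes> P \<otimes> P = pelt p [^] Suc (Suc m)" by (simp add: P_def Q_def)
  finally have "a [^] p \<ominus> b [^] p \<in> p_power_ideal p R (Suc (Suc m))"
    unfolding p_power_ideal_iff using P Q s(1) z(1) B
    by (intro bexI [of _ "s \<otimes> B \<oplus> s \<otimes> s \<otimes> z \<otimes> Q"]) simp_all
  then show ?thesis using a b by (intro ideal.rcos_eqI [OF ideal_p_power]) simp_all
qed

end

text \<open>Both homomorphisms preserve the decomposition \<open>x^p + p y\<close>, and each summand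
  gains one power of \<open>p\<close>: the first by \<open>pth_power_rcos\<close>, the second
  through its factor \<open>p\<close>. The induction ranges over all \<open>r\<close> because it is
  applied to the new elements \<open>x\<close> and \<open>y\<close>.\<close>

lemma ring_hom_eq_if_cong_p:
  assumes R: "cring R" "algebraically_closed (R Quot p_ideal p R)" "p > 0"
    and A: "cring A" "padically_complete p A"
    and fg: "f \<in> ring_hom R A" "g \<in> ring_hom R A"
    and cong: "\<And>r. r \<in> carrier R \<Longrightarrow> f r \<ominus>\<^bsub>A\<^esub> g r \<in> p_ideal p A"
    and r: "r \<in> carrier R"
  shows "f r = g r"
proof -
  interpret R: cring R by fact
  interpret A: cring A by fact
  interpret f: ring_hom_ring R A f by unfold_locales fact
  interpret g: ring_hom_ring R A g by unfold_locales fact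
  let ?I = "p_power_ideal p A"
  have cong_n: "?I (Suc n) +>\<^bsub>A\<^esub> f r = ?I (Suc n) +>\<^bsub>A\<^esub> g r" if "r \<in> carrier R" for n r
    using that
  proof (induction n arbitrary: r)
    case 0
    then show ?case
      using cong [OF 0] A.p_power_ideal_1 [of p]
      by (intro ideal.rcos_eqI [OF A.ideal_p_power]) simp_all
  next
    case (Suc n)
    obtain x y where xy: "x \<in> carrier R" "y \<in> carrier R"
      and r: "r = x [^]\<^bsub>R\<^esub> p \<oplus>\<^bsub>R\<^esub> R.pelt p \<otimes>\<^bsub>R\<^esub> y"
      by (rule R.pth_power_decomposition [OF R(2,3) Suc.prems])
    have pelt: "f (R.pelt p) = A.pelt p" "g (R.pelt p) = A.pelt p"
      using ring_hom_pelt [OF R(1) A(1) fg(1), of p 1] ring_hom_pelt [OF R(1) A(1) fg(2), of p 1]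
      by simp_all
    have "?I (Suc (Suc n)) +>\<^bsub>A\<^esub> f x [^]\<^bsub>A\<^esub> p = ?I (Suc (Suc n)) +>\<^bsub>A\<^esub> g x [^]\<^bsub>A\<^esub> p"
      using xy Suc.IH R(3) by (intro A.pth_power_rcos) simp_all
    moreover have "?I (Suc (Suc n)) +>\<^bsub>A\<^esub> (A.pelt p \<otimes>\<^bsub>A\<^esub> f y) = ?I (Suc (Suc n)) +>\<^bsub>A\<^esub> (A.pelt p \<otimes>\<^bsub>A\<^esub> g y)"
    proof (rule ideal.rcos_eqI [OF A.ideal_p_power])
      have "f y \<ominus>\<^bsub>A\<^esub> g y \<in> ?I (Suc n)"
        using xy Suc.IH by (intro ideal.rcos_eqD [OF A.ideal_p_power]) simp_all
      then obtain s where s: "s \<in> carrier A" "f y \<ominus>\<^bsub>A\<^esub> g y = s \<otimes>\<^bsub>A\<^esub> A.pelt p [^]\<^bsub>A\<^esub> Suc n"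
        using A.p_power_ideal_iff by blast
      have "A.pelt p \<otimes>\<^bsub>A\<^esub> f y \<ominus>\<^bsub>A\<^esub> A.pelt p \<otimes>\<^bsub>A\<^esub> g y = A.pelt p \<otimes>\<^bsub>A\<^esub> (f y \<ominus>\<^bsub>A\<^esub> g y)"
        using xy by (simp add: A.minus_eq A.r_distr A.r_minus)
      also have "\<dots> = s \<otimes>\<^bsub>A\<^esub> A.pelt p [^]\<^bsub>A\<^esub> Suc (Suc n)"
        unfolding s(2) A.nat_pow_Suc [of _ "Suc n"]
        by (simp only: A.m_ac s(1) A.pelt_closed A.nat_pow_closed A.m_closed)
      finally show "A.pelt p \<otimes>\<^bsub>A\<^esub> f y \<ominus>\<^bsub>A\<^esub> A.pelt p \<otimes>\<^bsub>A\<^esub> g y \<in> ?I (Suc (Suc n))"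
        using s(1) A.p_power_ideal_iff by blast
    qed (use xy in simp_all)
    ultimately have "?I (Suc (Suc n)) +>\<^bsub>A\<^esub> (f x [^]\<^bsub>A\<^esub> p \<oplus>\<^bsub>A\<^esub> A.pelt p \<otimes>\<^bsub>A\<^esub> f y)
        = ?I (Suc (Suc n)) +>\<^bsub>A\<^esub> (g x [^]\<^bsub>A\<^esub> p \<oplus>\<^bsub>A\<^esub> A.pelt p \<otimes>\<^bsub>A\<^esub> g y)"
      using xy by (intro ideal.rcos_add_eq [OF A.ideal_p_power]) simp_all
    moreover have "f r = f x [^]\<^bsub>A\<^esub> p \<oplus>\<^bsub>A\<^esub> A.pelt p \<otimes>\<^bsub>A\<^esub> f y"
      "g r = g x [^]\<^bsub>A\<^esub> p \<oplus>\<^bsub>A\<^esub> A.pelt p \<otimes>\<^bsub>A\<^esub> g y"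
      unfolding r using xy by (simp_all add: f.hom_nat_pow g.hom_nat_pow pelt)
    ultimately show ?case by simp
  qed
  show ?thesis
  proof (rule A.padically_separated [OF A(2)])
    fix n
    show "?I n +>\<^bsub>A\<^esub> f r = ?I n +>\<^bsub>A\<^esub> g r"
      \<comment> \<open>The induction starts modulo \<open>p\<close>, so level \<open>n\<close> is
        read off from level \<open>n + 1\<close>; this also covers \<open>n = 0\<close>.\<close>
      by (rule A.p_power_rcos_antimono [OF _ _ _ cong_n [OF r, of n]]) (use r in simp_all)
  qed (use r in simp_all)
qed

section \<open>Semilinearity of Frobenius lifts\<close>

context algebra
begin

lemma structure_map_hom: "structure_map M \<in> ring_hom R M"
proof (rule ring_hom_memI)
  fix r s assume rs: "r \<in> carrier R" "s \<in> carrier R"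
  show "structure_map M (r \<otimes>\<^bsub>R\<^esub> s) = structure_map M r \<otimes>\<^bsub>M\<^esub> structure_map M s"
    using rs by (simp add: structure_map_def smult_assoc1 smult_assoc2)
  show "structure_map M (r \<oplus>\<^bsub>R\<^esub> s) = structure_map M r \<oplus>\<^bsub>M\<^esub> structure_map M s"
    using rs by (simp add: structure_map_def smult_l_distr)
qed (simp_all add: structure_map_def)

lemma smult_structure_map:
  "\<lbrakk>r \<in> carrier R; x \<in> carrier M\<rbrakk> \<Longrightarrow> r \<odot>\<^bsub>M\<^esub> x = structure_map M r \<otimes>\<^bsub>M\<^esub> x"
  by (simp add: structure_map_def smult_assoc2)

end

text \<open>Going from \<open>R\<close> to \<open>A\<close> before or after the Frobenius lift gives
  two ring homomorphisms that are both congruent to the \<open>p\<close>-th power of the image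
  modulo \<open>p\<close>. They are therefore equal, and multiplicativity of \<open>\<phi>\<close>
  does the rest.\<close>

lemma frobenius_lift_smult:
  assumes A: "algebra R A" "padically_complete p A" and p: "p > 0"
    and R: "algebraically_closed (R Quot p_ideal p R)"
    and \<sigma>: "frobenius_lift p R \<sigma>" and \<phi>: "frobenius_lift p A \<phi>"
    and ra: "r \<in> carrier R" "a \<in> carrier A"
  shows "\<phi> (r \<odot>\<^bsub>A\<^esub> a) = \<sigma> r \<odot>\<^bsub>A\<^esub> \<phi> a"
proof -
  interpret A: algebra R A by fact
  have RC: "cring R" and AC: "cring A" by (rule A.R_cring A.M_cring)+
  note s = A.structure_map_hom
  have \<sigma>h: "\<sigma> \<in> ring_hom R R" and \<phi>h: "\<phi> \<in> ring_hom A A"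
    using \<sigma> \<phi> by (simp_all add: frobenius_lift_def)
  interpret s: ring_hom_ring R A "structure_map A" by unfold_locales (rule s)
  interpret I: ideal "p_ideal p A" A by (rule A.cgenideal_ideal) simp
  have \<sigma>c: "\<sigma> t \<in> carrier R" if "t \<in> carrier R" for t using ring_hom_closed [OF \<sigma>h that] .
  have \<phi>c: "\<phi> t \<in> carrier A" if "t \<in> carrier A" for t using ring_hom_closed [OF \<phi>h that] .
  have cong: "(\<phi> \<circ> structure_map A) t \<ominus>\<^bsub>A\<^esub> (structure_map A \<circ> \<sigma>) t \<in> p_ideal p A" if t: "t \<in> carrier R" for t
  proof -
    let ?x = "structure_map A t"
    have x: "?x \<in> carrier A" using t by simp
    have "\<phi> ?x \<ominus>\<^bsub>A\<^esub> ?x [^]\<^bsub>A\<^esub> p \<in> p_ideal p A" using \<phi> x by (simp add: frobenius_lift_def)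
    then have 1: "p_ideal p A +>\<^bsub>A\<^esub> \<phi> ?x = p_ideal p A +>\<^bsub>A\<^esub> ?x [^]\<^bsub>A\<^esub> p"
      using x \<phi>c by (intro I.rcos_eqI) simp_all
    have "\<sigma> t \<ominus>\<^bsub>R\<^esub> t [^]\<^bsub>R\<^esub> p \<in> p_power_ideal p R 1"
      using \<sigma> t unfolding A.R.p_power_ideal_1 by (simp add: frobenius_lift_def)
    then have "structure_map A (\<sigma> t \<ominus>\<^bsub>R\<^esub> t [^]\<^bsub>R\<^esub> p) \<in> p_power_ideal p A 1"
      by (rule ring_hom_p_power_ideal [OF RC AC s])
    then have "structure_map A (\<sigma> t) \<ominus>\<^bsub>A\<^esub> ?x [^]\<^bsub>A\<^esub> p \<in> p_ideal p A"
      unfolding A.p_power_ideal_1 using t \<sigma>c by (simp add: A.R.minus_eq A.minus_eq s.hom_nat_pow)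
    then have "p_ideal p A +>\<^bsub>A\<^esub> structure_map A (\<sigma> t) = p_ideal p A +>\<^bsub>A\<^esub> ?x [^]\<^bsub>A\<^esub> p"
      using x t \<sigma>c by (intro I.rcos_eqI) simp_all
    with 1 show ?thesis using x t \<sigma>c \<phi>c by (intro I.rcos_eqD) simp_all
  qed
  have "(\<phi> \<circ> structure_map A) r = (structure_map A \<circ> \<sigma>) r"
    by (rule ring_hom_eq_if_cong_p [OF RC R p AC A(2) ring_hom_trans [OF s \<phi>h]
        ring_hom_trans [OF \<sigma>h s] cong ra(1)])
  then show ?thesis
    using ra \<sigma>c \<phi>c by (simp add: A.smult_structure_map ring_hom_mult [OF \<phi>h])
qed

section \<open>The ring generated by the p-power roots\<close>

text \<open>The union of the simple extensions is a ring because they form a chain: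
  \<open>\<pi> m\<close> is the \<open>p\<close>-th power of \<open>\<pi> (Suc m)\<close>.\<close>

lemma cring_adjoin_p_roots:
  assumes R: "cring R" and L: "field L" and j: "j \<in> ring_hom R L" and \<pi>: "compatible_p_roots p L \<pi>"
  shows "cring (adjoin_p_roots R L j \<pi>)" and "j ` carrier R \<subseteq> carrier (adjoin_p_roots R L j \<pi>)"
proof -
  interpret R: cring R by fact
  interpret L: field L by fact
  interpret j: ring_hom_ring R L j by unfold_locales fact
  let ?S = "\<lambda>m. ring.simple_extension L (j ` carrier R) (\<pi> m)"
  have \<pi>c: "\<pi> m \<in> carrier L" and \<pi>p: "\<pi> (Suc m) [^]\<^bsub>L\<^esub> p = \<pi> m" for m
    using \<pi> by (simp_all add: compatible_p_roots_def)
  have jR: "subring (j ` carrier R) L" by (rule j.img_is_subring [OF R.carrier_is_subring])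
  have S: "subring (?S m) L" for m by (rule L.simple_extension_is_subring [OF jR \<pi>c])
  have jS: "j ` carrier R \<subseteq> ?S m" for m
    by (rule L.simple_extension_incl [OF subringE(1) [OF jR] \<pi>c])
  have S_Suc: "?S m \<subseteq> ?S (Suc m)" for m
  proof (rule L.simple_extension_subring_incl [OF S jS])
    have pow: "\<pi> (Suc m) [^]\<^bsub>L\<^esub> n \<in> ?S (Suc m)" for n :: nat
      by (induction n)
        (simp_all add: subringE(3) [OF S] subringE(6) [OF S] L.simple_extension_mem [OF jR \<pi>c])
    show "\<pi> m \<in> ?S (Suc m)" using pow [of p] by (simp add: \<pi>p)
  qed
  have S_mono: "?S m \<subseteq> ?S n" if "m \<le> n" for m n
    using that by (rule lift_Suc_mono_le [of ?S, OF S_Suc])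
  have "subring (\<Union>m. ?S m) L"
  proof (rule L.subringI)
    show "(\<Union>m. ?S m) \<subseteq> carrier L" using subringE(1) [OF S] by blast
    show "\<one>\<^bsub>L\<^esub> \<in> (\<Union>m. ?S m)" using subringE(3) [OF S] by blast
    show "\<ominus>\<^bsub>L\<^esub> h \<in> (\<Union>m. ?S m)" if "h \<in> (\<Union>m. ?S m)" for h using that subringE(5) [OF S] by blast
  next
    fix a b assume "a \<in> (\<Union>m. ?S m)" "b \<in> (\<Union>m. ?S m)"
    then obtain m n where "a \<in> ?S m" "b \<in> ?S n" by blast
    then have ab: "a \<in> ?S (max m n)" "b \<in> ?S (max m n)"
      using S_mono [of m "max m n"] S_mono [of n "max m n"] by auto
    show "a \<otimes>\<^bsub>L\<^esub> b \<in> (\<Union>m. ?S m)" using subringE(6) [OF S ab] by blast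
    show "a \<oplus>\<^bsub>L\<^esub> b \<in> (\<Union>m. ?S m)" using subringE(7) [OF S ab] by blast
  qed
  then have "subcring (\<Union>m. ?S m) L" by (rule L.subcringI')
  then show "cring (adjoin_p_roots R L j \<pi>)"
    unfolding adjoin_p_roots_def using L.subcring_iff [OF subcringE(1)] by blast
  show "j ` carrier R \<subseteq> carrier (adjoin_p_roots R L j \<pi>)"
    using jS by (auto simp: adjoin_p_roots_def)
qed

section \<open>Assembly of the universal property\<close>

text \<open>A formal version over a general base \<open>K\<close>: the arithmetic of Frobenius lifts
  enters only through the semilinearity hypotheses, and \<open>R\<close>-linearity of
  \<open>u\<^sub>1\<close> through \<open>balanced\<close>.\<close>

lemma Pcirc_universal:
  assumes AK: "tensor_algebras R A K"
    and \<phi>: "\<phi> \<in> ring_hom A A" and \<Phi>\<^sub>K: "\<Phi>\<^sub>K \<in> ring_hom K K"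
    and \<sigma>: "\<And>r. r \<in> carrier R \<Longrightarrow> \<sigma> r \<in> carrier R"
    and \<phi>_smult: "\<And>r a. \<lbrakk>r \<in> carrier R; a \<in> carrier A\<rbrakk> \<Longrightarrow> \<phi> (r \<odot>\<^bsub>A\<^esub> a) = \<sigma> r \<odot>\<^bsub>A\<^esub> \<phi> a"
    and \<Phi>\<^sub>K_smult: "\<And>r k. \<lbrakk>r \<in> carrier R; k \<in> carrier K\<rbrakk> \<Longrightarrow> \<Phi>\<^sub>K (r \<odot>\<^bsub>K\<^esub> k) = \<sigma> r \<odot>\<^bsub>K\<^esub> \<Phi>\<^sub>K k"
    and C: "algebra K C" "padically_complete p C"
    and \<Phi>\<^sub>C: "\<Phi>\<^sub>C \<in> ring_hom C C" "bij_betw \<Phi>\<^sub>C (carrier C) (carrier C)"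
      "\<And>k. k \<in> carrier K \<Longrightarrow> \<Phi>\<^sub>C (structure_map C k) = structure_map C (\<Phi>\<^sub>K k)"
    and u\<^sub>1: "u\<^sub>1 \<in> ring_hom A C" "\<And>a. a \<in> carrier A \<Longrightarrow> u\<^sub>1 (\<phi> a) = \<Phi>\<^sub>C (u\<^sub>1 a)"
    and balanced: "\<And>r a k. \<lbrakk>r \<in> carrier R; a \<in> carrier A; k \<in> carrier K\<rbrakk> \<Longrightarrow>
      u\<^sub>1 (r \<odot>\<^bsub>A\<^esub> a) \<otimes>\<^bsub>C\<^esub> structure_map C k = u\<^sub>1 a \<otimes>\<^bsub>C\<^esub> structure_map C (r \<odot>\<^bsub>K\<^esub> k)"
  shows "\<exists>!u. u \<in> extensional (carrier (Pcirc p R K \<Phi>\<^sub>K A \<phi>)) \<and>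
           u \<in> algebra_hom K (Pcirc p R K \<Phi>\<^sub>K A \<phi>) C \<and>
           (\<forall>a\<in>carrier A. u (Pcirc_incl p R K \<Phi>\<^sub>K A \<phi> a) = u\<^sub>1 a) \<and>
           (\<forall>x\<in>carrier (Pcirc p R K \<Phi>\<^sub>K A \<phi>). \<Phi>\<^sub>C (u x) = u (Pcirc_endo p R K \<Phi>\<^sub>K A \<phi> x))"
proof -
  interpret tensor_algebras R A K by fact
  interpret C: algebra K C by fact
  have CC: "cring C" by (rule C.M_cring)
  define N where "N = base_change R A K"
  define \<Phi> where "\<Phi> = tensor_endo R A K \<phi> \<Phi>\<^sub>K"
  let ?\<tau> = "pure_tensor R A K"
  have \<Phi>: "\<Phi> \<in> ring_hom N N"
    and \<Phi>_\<tau>: "\<And>a k. \<lbrakk>a \<in> carrier A; k \<in> carrier K\<rbrakk> \<Longrightarrow> \<Phi> (?\<tau> a k) = ?\<tau> (\<phi> a) (\<Phi>\<^sub>K k)"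
    unfolding \<Phi>_def N_def by (rule tensor_endo_hom [OF \<phi> \<Phi>\<^sub>K \<sigma> \<phi>_smult \<Phi>\<^sub>K_smult]; assumption)+
  have NC: "cring N" unfolding N_def by (rule cring_base_change)
  interpret N: cring_endo N \<Phi> by (intro cring_endo.intro cring_endo_axioms.intro NC \<Phi>)
  let ?cls = "dirlim_class N \<Phi>" and ?D = "dirlim_ring N \<Phi>"
  have \<tau>c: "?\<tau> a k \<in> carrier N" if "a \<in> carrier A" "k \<in> carrier K" for a k
    using pure_tensor_closed that by (simp add: N_def)
  define E where "E = perfection R K \<Phi>\<^sub>K A \<phi>"
  have E_eq: "E = algebra_via (\<lambda>k. ?cls (structure_map N k) 1) ?D"
    by (simp add: E_def perfection_def dirlim_def N_def \<Phi>_def)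
  have EC: "cring E" unfolding E_eq by (rule cring_algebra_via [OF N.cring_dirlim])
  interpret E: cring E by (rule EC)
  let ?P = "padic_completion p E" and ?to = "to_completion p E"
  define P where "P = Pcirc p R K \<Phi>\<^sub>K A \<phi>"
  define F where "F = dirlim_endo N \<Phi>"
  have F: "F \<in> ring_hom E E"
    using N.dirlim_endo_hom by (simp add: E_eq F_def)
  have P_endo: "Pcirc_endo p R K \<Phi>\<^sub>K A \<phi> = completion_endo p E F"
    by (simp add: fun_eq_iff Pcirc_endo_def perfection_endo_def E_def F_def N_def \<Phi>_def)
  have P_incl: "Pcirc_incl p R K \<Phi>\<^sub>K A \<phi> a = ?to (?cls (?\<tau> a \<one>\<^bsub>K\<^esub>) 1)" for a
    by (simp add: Pcirc_incl_def E_def N_def \<Phi>_def)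
  have E_struct: "structure_map E k = ?cls (?\<tau> \<one>\<^bsub>A\<^esub> k) 1" if k: "k \<in> carrier K" for k
  proof -
    have "structure_map E k = ?cls (structure_map N k) 1 \<otimes>\<^bsub>?D\<^esub> \<one>\<^bsub>?D\<^esub>"
      by (simp add: structure_map_def E_eq)
    also have "structure_map N k = ?\<tau> \<one>\<^bsub>A\<^esub> k"
      unfolding N_def by (rule structure_map_base_change [OF k])
    finally show ?thesis using \<tau>c [OF A.one_closed k] by (simp add: N.dirlim_one [of 1])
  qed
  have clsB: "?cls x 1 \<in> carrier E" if "x \<in> carrier N" for x
    using that by (simp add: E_eq)
  have P_eq: "P = algebra_via (\<lambda>k. ?to (structure_map E k)) ?P"
    by (simp add: P_def Pcirc_def E_def)
  have P_smult: "k \<odot>\<^bsub>P\<^esub> x = ?to (?cls (?\<tau> \<one>\<^bsub>A\<^esub> k) 1) \<otimes>\<^bsub>?P\<^esub> x" if "k \<in> carrier K" for k x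
    by (simp add: P_eq E_struct [OF that])
  note \<beta> = C.structure_map_hom
  have u1c: "u\<^sub>1 a \<in> carrier C" if "a \<in> carrier A" for a using ring_hom_closed [OF u\<^sub>1(1) that] .
  have \<beta>c: "structure_map C k \<in> carrier C" if "k \<in> carrier K" for k using ring_hom_closed [OF \<beta> that] .
  obtain v where v: "v \<in> ring_hom N C"
    and v_\<tau>: "\<forall>a\<in>carrier A. \<forall>k\<in>carrier K. v (?\<tau> a k) = u\<^sub>1 a \<otimes>\<^bsub>C\<^esub> structure_map C k"
    unfolding N_def using base_change_lift [OF CC u\<^sub>1(1) \<beta> balanced] by blast
  \<comment> \<open>Pure tensors decide. There the factor from \<open>A\<close> is the compatibility
    of \<open>u\<^sub>1\<close> with the Frobenius lifts, and the factor from \<open>K\<close> is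
    the fact that \<open>\<Phi>\<^sub>C\<close> extends \<open>\<Phi>\<^sub>K\<close>.\<close>
  have v_comm: "v (\<Phi> x) = \<Phi>\<^sub>C (v x)" if x: "x \<in> carrier N" for x
  proof -
    have "(v \<circ> \<Phi>) x = (\<Phi>\<^sub>C \<circ> v) x"
    proof (rule base_change_hom_ext [OF C.ring_axioms])
      show "v \<circ> \<Phi> \<in> ring_hom (base_change R A K) C"
        using ring_hom_trans [OF \<Phi> v] by (simp add: N_def)
      show "\<Phi>\<^sub>C \<circ> v \<in> ring_hom (base_change R A K) C"
        using ring_hom_trans [OF v \<Phi>\<^sub>C(1)] by (simp add: N_def)
      show "x \<in> carrier (base_change R A K)" using x by (simp add: N_def)
      fix a k assume "a \<in> carrier A" "k \<in> carrier K"
      then show "(v \<circ> \<Phi>) (?\<tau> a k) = (\<Phi>\<^sub>C \<circ> v) (?\<tau> a k)"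
        using ring_hom_closed [OF \<phi>] ring_hom_closed [OF \<Phi>\<^sub>K]
        by (simp add: \<Phi>_\<tau> v_\<tau> u\<^sub>1(2) \<Phi>\<^sub>C(3) [symmetric] ring_hom_mult [OF \<Phi>\<^sub>C(1)] u1c \<beta>c)
    qed
    then show ?thesis by simp
  qed
  obtain w where w: "w \<in> ring_hom ?D C" and w_cls: "\<forall>x\<in>carrier N. w (?cls x 1) = v x"
    and w_comm: "\<forall>y\<in>carrier ?D. \<Phi>\<^sub>C (w y) = w (F y)"
    unfolding F_def using N.dirlim_lift [OF CC \<Phi>\<^sub>C(1,2) v v_comm] by blast
  have wB: "w \<in> ring_hom E C" using w by (simp add: E_eq)
  obtain u where u: "u \<in> ring_hom ?P C" and u_to: "\<forall>b\<in>carrier E. u (?to b) = w b"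
    and u_comm: "\<forall>x\<in>carrier ?P. \<Phi>\<^sub>C (u x) = u (completion_endo p E F x)"
    using completion_lift [OF EC CC C(2) wB] F \<Phi>\<^sub>C(1) w_comm by (auto simp: E_eq)
  have u_\<tau>: "u (?to (?cls (?\<tau> a k) 1)) = u\<^sub>1 a \<otimes>\<^bsub>C\<^esub> structure_map C k"
    if "a \<in> carrier A" "k \<in> carrier K" for a k
    using that u_to clsB [OF \<tau>c [OF that]] w_cls \<tau>c [OF that] v_\<tau> by simp
  \<comment> \<open>Functions are total, so uniqueness makes sense only after values outside the
    carrier are fixed to \<open>undefined\<close>.\<close>
  define u' where "u' = restrict u (carrier ?P)"
  have u': "u' x = u x" if "x \<in> carrier ?P" for x using that by (simp add: u'_def)
  have carrier_P: "carrier P = carrier ?P" by (simp add: P_eq)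
  have u'_hom: "u' \<in> ring_hom ?P C"
    using E.to_completion_closed [OF E.one_closed, of p]
    by (intro ring_hom_memI)
      (simp_all add: u' E.completion_op_closed ring_hom_closed [OF u] ring_hom_mult [OF u]
        ring_hom_add [OF u] ring_hom_one [OF u] ring_hom_one [OF E.to_completion_hom])
  have to_closed: "?to (?cls (?\<tau> a k) 1) \<in> carrier ?P" if "a \<in> carrier A" "k \<in> carrier K" for a k
    by (rule E.to_completion_closed [OF clsB [OF \<tau>c [OF that]]])
  have u'_alg: "u' \<in> algebra_hom K P C"
    unfolding algebra_hom_def
  proof (intro CollectI conjI ballI)
    show "u' \<in> ring_hom P C" using u'_hom by (simp add: P_eq)
    fix k x assume k: "k \<in> carrier K" and x: "x \<in> carrier P"
    then have x: "x \<in> carrier ?P" by (simp add: carrier_P)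
    \<comment> \<open>Scalars act through the first copy, so linearity amounts to multiplicativity
      together with the value of \<open>u'\<close> at the image of
      \<open>[1 \<otimes> k, 1]\<close>.\<close>
    have "u' (k \<odot>\<^bsub>P\<^esub> x) = u' (?to (?cls (?\<tau> \<one>\<^bsub>A\<^esub> k) 1)) \<otimes>\<^bsub>C\<^esub> u' x"
      unfolding P_smult [OF k] by (rule ring_hom_mult [OF u'_hom to_closed [OF A.one_closed k] x])
    also have "u' (?to (?cls (?\<tau> \<one>\<^bsub>A\<^esub> k) 1)) = structure_map C k"
      unfolding u' [OF to_closed [OF A.one_closed k]] u_\<tau> [OF A.one_closed k]
      using k by (simp add: ring_hom_one [OF u\<^sub>1(1)] \<beta>c)
    also have "structure_map C k \<otimes>\<^bsub>C\<^esub> u' x = k \<odot>\<^bsub>C\<^esub> u' x"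
      by (rule C.smult_structure_map [symmetric, OF k ring_hom_closed [OF u'_hom x]])
    finally show "u' (k \<odot>\<^bsub>P\<^esub> x) = k \<odot>\<^bsub>C\<^esub> u' x" .
  qed
  have u'_incl: "u' (Pcirc_incl p R K \<Phi>\<^sub>K A \<phi> a) = u\<^sub>1 a" if a: "a \<in> carrier A" for a
    unfolding P_incl u' [OF to_closed [OF a B.one_closed]] u_\<tau> [OF a B.one_closed]
    using a by (simp add: ring_hom_one [OF \<beta>] u1c)
  have u'_comm: "\<Phi>\<^sub>C (u' x) = u' (Pcirc_endo p R K \<Phi>\<^sub>K A \<phi> x)" if x: "x \<in> carrier P" for x
    using x u_comm completion_endo_closed [OF EC F, of x p]
    by (simp add: carrier_P P_endo u')
  have unique: "h = u'"
    if h_ext: "h \<in> extensional (carrier P)" and h: "h \<in> algebra_hom K P C"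
      and h_incl: "\<forall>a\<in>carrier A. h (Pcirc_incl p R K \<Phi>\<^sub>K A \<phi> a) = u\<^sub>1 a"
      and h_comm: "\<forall>x\<in>carrier P. \<Phi>\<^sub>C (h x) = h (Pcirc_endo p R K \<Phi>\<^sub>K A \<phi> x)" for h
  proof -
    have h_hom: "h \<in> ring_hom ?P C" using h by (simp add: algebra_hom_def P_eq)
    note to_hom = E.to_completion_hom [of p]
    have cls_hom: "(\<lambda>x. ?cls x 1) \<in> ring_hom N E"
      using N.dirlim_class_hom by (simp add: E_eq)
    have h_N: "h (?to (?cls x 1)) = v x" if x: "x \<in> carrier N" for x
    proof -
      have hN: "(h \<circ> ?to) \<circ> (\<lambda>x. ?cls x 1) \<in> ring_hom N C"
        by (rule ring_hom_trans [OF cls_hom ring_hom_trans [OF to_hom h_hom]])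
      have "((h \<circ> ?to) \<circ> (\<lambda>x. ?cls x 1)) x = v x"
      proof (rule base_change_hom_ext [OF C.ring_axioms])
        show "(h \<circ> ?to) \<circ> (\<lambda>x. ?cls x 1) \<in> ring_hom (base_change R A K) C"
          "v \<in> ring_hom (base_change R A K) C" "x \<in> carrier (base_change R A K)"
          using hN v x by (simp_all only: N_def)
        fix a k assume ak: "a \<in> carrier A" "k \<in> carrier K"
        have 1: "h (?to (?cls (?\<tau> a \<one>\<^bsub>K\<^esub>) 1)) = u\<^sub>1 a"
          using h_incl ak(1) by (simp only: P_incl)
        \<comment> \<open>The image of \<open>k\<close> in \<open>P\<close> is \<open>k\<close>
          times the unit, so \<open>K\<close>-linearity of \<open>h\<close> dictates its value
          there; on the image of \<open>A\<close> the value is \<open>h_incl\<close>.\<close>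
        have "?to (?cls (?\<tau> \<one>\<^bsub>A\<^esub> k) 1) = k \<odot>\<^bsub>P\<^esub> ?to \<one>\<^bsub>E\<^esub>"
          unfolding P_smult [OF ak(2)]
          using clsB [OF \<tau>c [OF A.one_closed ak(2)]]
          by (simp add: ring_hom_mult [OF to_hom, symmetric])
        then have "h (?to (?cls (?\<tau> \<one>\<^bsub>A\<^esub> k) 1)) = h (k \<odot>\<^bsub>P\<^esub> ?to \<one>\<^bsub>E\<^esub>)"
          by (rule arg_cong)
        also have "\<dots> = k \<odot>\<^bsub>C\<^esub> h (?to \<one>\<^bsub>E\<^esub>)"
          using h ak(2) by (simp add: algebra_hom_def carrier_P)
        also have "\<dots> = structure_map C k"
          by (simp add: structure_map_def ring_hom_one [OF to_hom] ring_hom_one [OF h_hom])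
        finally have 2: "h (?to (?cls (?\<tau> \<one>\<^bsub>A\<^esub> k) 1)) = structure_map C k" .
        have "?\<tau> a k = ?\<tau> a \<one>\<^bsub>K\<^esub> \<otimes>\<^bsub>N\<^esub> ?\<tau> \<one>\<^bsub>A\<^esub> k"
          unfolding N_def by (rule pure_tensor_split [OF ak])
        then have "((h \<circ> ?to) \<circ> (\<lambda>x. ?cls x 1)) (?\<tau> a k) = u\<^sub>1 a \<otimes>\<^bsub>C\<^esub> structure_map C k"
          using ring_hom_mult [OF hN \<tau>c [OF ak(1) B.one_closed] \<tau>c [OF A.one_closed ak(2)]] 1 2
          by simp
        also have "\<dots> = v (?\<tau> a k)" using v_\<tau> ak by simp
        finally show "((h \<circ> ?to) \<circ> (\<lambda>x. ?cls x 1)) (?\<tau> a k) = v (?\<tau> a k)" .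
      qed
      then show ?thesis by simp
    qed
    \<comment> \<open>On the image of the direct limit the completed endomorphism is
      \<open>F\<close>, so commutation on \<open>P\<close> yields the commutation that
      \<open>dirlim_ext\<close> asks for.\<close>
    have h_comm': "\<Phi>\<^sub>C (h (?to y)) = h (?to (F y))" if y: "y \<in> carrier E" for y
    proof -
      have "completion_endo p E F (?to y) = ?to (F y)"
        using completion_endo_mem [OF EC F E.to_completion_closed [OF y] E.to_completion_mem [OF y]]
        by (auto simp: to_completion_def)
      then show ?thesis
        using h_comm E.to_completion_closed [OF y, of p] by (simp add: carrier_P P_endo)
    qed
    have h_to: "h (?to b) = u (?to b)" if b: "b \<in> carrier E" for b
    proof (rule N.dirlim_ext [where w = "\<lambda>b. h (?to b)" and w' = "\<lambda>b. u (?to b)"])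
      show "inj_on \<Phi>\<^sub>C (carrier C)" by (rule bij_betw_imp_inj_on [OF \<Phi>\<^sub>C(2)])
      show "b \<in> carrier ?D" using b by (simp add: E_eq)
      fix y assume "y \<in> carrier ?D"
      then have y: "y \<in> carrier E" by (simp add: E_eq)
      show "h (?to y) \<in> carrier C" "u (?to y) \<in> carrier C"
        using y by (simp_all add: ring_hom_closed [OF h_hom] ring_hom_closed [OF u])
      show "\<Phi>\<^sub>C (h (?to y)) = h (?to (dirlim_endo N \<Phi> y))"
        using h_comm' [OF y] by (simp add: F_def)
      show "\<Phi>\<^sub>C (u (?to y)) = u (?to (dirlim_endo N \<Phi> y))"
        using y u_to w_comm ring_hom_closed [OF F y] by (simp add: F_def E_eq)
    next
      fix x assume x: "x \<in> carrier N"
      show "h (?to (?cls x 1)) = u (?to (?cls x 1))"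
        using h_N [OF x] u_to clsB [OF x] w_cls x by simp
    qed
    show ?thesis
    proof (rule extensionalityI [OF h_ext])
      show "u' \<in> extensional (carrier P)" by (simp add: u'_def carrier_P)
      fix x assume "x \<in> carrier P"
      then have x: "x \<in> carrier ?P" by (simp add: carrier_P)
      show "h x = u' x"
        unfolding u' [OF x] by (rule completion_hom_ext [OF EC CC C(2) h_hom u h_to x])
    qed
  qed
  show ?thesis
    unfolding P_def [symmetric]
  proof (rule ex1I [of _ u'])
    show "u' \<in> extensional (carrier P) \<and> u' \<in> algebra_hom K P C \<and>
        (\<forall>a\<in>carrier A. u' (Pcirc_incl p R K \<Phi>\<^sub>K A \<phi> a) = u\<^sub>1 a) \<and>
        (\<forall>x\<in>carrier P. \<Phi>\<^sub>C (u' x) = u' (Pcirc_endo p R K \<Phi>\<^sub>K A \<phi> x))"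
      using u'_alg u'_incl u'_comm by (simp add: u'_def carrier_P)
  qed (use unique in blast)
qed

theorem theorem3p11:
  fixes p :: nat
    and R :: "'r ring" and \<sigma> :: "'r \<Rightarrow> 'r"
    and L :: "'l ring" and j :: "'r \<Rightarrow> 'l" and \<pi> :: "nat \<Rightarrow> 'l"
    and K :: "('r, nat \<Rightarrow> 'l set) module" and \<Phi>\<^sub>K :: "(nat \<Rightarrow> 'l set) \<Rightarrow> (nat \<Rightarrow> 'l set)"
    and A :: "('r, 'a) module" and \<phi> :: "'a \<Rightarrow> 'a"
    and C :: "(nat \<Rightarrow> 'l set, 'c) module" and \<Phi>\<^sub>C :: "'c \<Rightarrow> 'c"
    and u\<^sub>1 :: "'a \<Rightarrow> 'c"
  assumes p: "Factorial_Ring.prime p" "odd p"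
    and R: "discrete_valuation_ring R" "maximalideal (p_ideal p R) R" "padically_complete p R"
      "algebraically_closed (R Quot p_ideal p R)"
    and \<sigma>: "frobenius_lift p R \<sigma>"
    and L: "field L" "j \<in> ring_hom R L" "inj_on j (carrier R)" "compatible_p_roots p L \<pi>"
    and K: "K = Kcirc p R L j \<pi>"
    and \<Phi>\<^sub>K: "canonical_frobenius R \<sigma> K (Kcirc_root p R L j \<pi>) \<Phi>\<^sub>K"
    and A: "algebra R A" "p_torsion_free p A" "padically_complete p A"
      "reduced_ring (A Quot p_ideal p A)"
    and \<phi>: "frobenius_lift p A \<phi>"
    and C: "algebra K C" "padically_complete p C"
    and \<Phi>\<^sub>C: "relative_frobenius_lift p K \<Phi>\<^sub>K C \<Phi>\<^sub>C" "bij_betw \<Phi>\<^sub>C (carrier C) (carrier C)"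
    and u\<^sub>1: "u\<^sub>1 \<in> algebra_hom R A (restrict_scalars K C)"
      "\<forall>a\<in>carrier A. u\<^sub>1 (\<phi> a) = \<Phi>\<^sub>C (u\<^sub>1 a)"
  shows "\<exists>!u. u \<in> extensional (carrier (Pcirc p R K \<Phi>\<^sub>K A \<phi>)) \<and>
           u \<in> algebra_hom K (Pcirc p R K \<Phi>\<^sub>K A \<phi>) C \<and>
           (\<forall>a\<in>carrier A. u (Pcirc_incl p R K \<Phi>\<^sub>K A \<phi> a) = u\<^sub>1 a) \<and>
           (\<forall>x\<in>carrier (Pcirc p R K \<Phi>\<^sub>K A \<phi>). \<Phi>\<^sub>C (u x) = u (Pcirc_endo p R K \<Phi>\<^sub>K A \<phi> x))"
proof -
  interpret A: algebra R A by fact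
  interpret C: algebra K C by fact
  interpret L: field L by fact
  let ?S = "adjoin_p_roots R L j \<pi>"
  have "cring ?S" by (rule cring_adjoin_p_roots(1) [OF A.R_cring L(1,2,4)])
  then interpret S: cring ?S .
  let ?t = "\<lambda>r. to_completion p ?S (j r)"
  have "j r \<in> carrier ?S" if "r \<in> carrier R" for r
    using cring_adjoin_p_roots(2) [OF A.R_cring L(1,2,4)] that by blast
  then have t: "?t r \<in> carrier K" if "r \<in> carrier R" for r
    using that by (simp add: K Kcirc_def)
  have smult_K: "r \<odot>\<^bsub>K\<^esub> k = ?t r \<otimes>\<^bsub>K\<^esub> k" for r k
    by (simp add: K Kcirc_def)
  have struct_K: "structure_map K r = ?t r" if "r \<in> carrier R" for r
    using t [OF that] by (simp add: structure_map_def smult_K)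
  have p0: "p > 0" using p(1) prime_gt_0_nat by blast
  have \<sigma>_hom: "\<sigma> \<in> ring_hom R R" and \<phi>_hom: "\<phi> \<in> ring_hom A A"
    using \<sigma> \<phi> by (simp_all add: frobenius_lift_def)
  have \<Phi>K_hom: "\<Phi>\<^sub>K \<in> ring_hom K K"
    and \<Phi>K_struct: "\<And>r. r \<in> carrier R \<Longrightarrow> \<Phi>\<^sub>K (structure_map K r) = structure_map K (\<sigma> r)"
    using \<Phi>\<^sub>K by (simp_all add: canonical_frobenius_def ring_iso_def)
  have u1_hom: "u\<^sub>1 \<in> ring_hom A C"
    and u1_smult: "\<And>r a. \<lbrakk>r \<in> carrier R; a \<in> carrier A\<rbrakk> \<Longrightarrow>
      u\<^sub>1 (r \<odot>\<^bsub>A\<^esub> a) = structure_map C (structure_map K r) \<otimes>\<^bsub>C\<^esub> u\<^sub>1 a"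
    using u\<^sub>1(1) by (simp_all add: algebra_hom_def restrict_scalars_def)
  note \<beta> = C.structure_map_hom
  show ?thesis
  proof (rule Pcirc_universal [where \<sigma> = \<sigma>])
    show "tensor_algebras R A K"
      \<comment> \<open>That \<open>K\<close> is a commutative ring is part of \<open>C\<close>
        being a \<open>K\<close>-algebra.\<close>
      by (intro tensor_algebras.intro tensor_algebras_axioms.intro A.M_cring C.R_cring)
        (simp_all add: smult_K t)
    show "\<sigma> r \<in> carrier R" if "r \<in> carrier R" for r
      by (rule ring_hom_closed [OF \<sigma>_hom that])
    show "\<phi> (r \<odot>\<^bsub>A\<^esub> a) = \<sigma> r \<odot>\<^bsub>A\<^esub> \<phi> a" if "r \<in> carrier R" "a \<in> carrier A" for r a
      by (rule frobenius_lift_smult [OF A(1,3) p0 R(4) \<sigma> \<phi> that])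
    show "\<Phi>\<^sub>K (r \<odot>\<^bsub>K\<^esub> k) = \<sigma> r \<odot>\<^bsub>K\<^esub> \<Phi>\<^sub>K k" if r: "r \<in> carrier R" and k: "k \<in> carrier K" for r k
      using \<Phi>K_struct [OF r] ring_hom_mult [OF \<Phi>K_hom t [OF r] k] ring_hom_closed [OF \<sigma>_hom r] r
      by (simp add: smult_K struct_K)
    show "\<Phi>\<^sub>C \<in> ring_hom C C" using \<Phi>\<^sub>C(1) by (simp add: relative_frobenius_lift_def)
    show "\<Phi>\<^sub>C (structure_map C k) = structure_map C (\<Phi>\<^sub>K k)" if "k \<in> carrier K" for k
      using \<Phi>\<^sub>C(1) that by (simp_all add: relative_frobenius_lift_def)
    \<comment> \<open>Both sides are the product of \<open>u\<^sub>1 a\<close> with the images of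
      \<open>r\<close> and \<open>k\<close> in \<open>C\<close>, since \<open>R\<close> acts on
      \<open>C\<close> through \<open>K\<close>.\<close>
    show "u\<^sub>1 (r \<odot>\<^bsub>A\<^esub> a) \<otimes>\<^bsub>C\<^esub> structure_map C k = u\<^sub>1 a \<otimes>\<^bsub>C\<^esub> structure_map C (r \<odot>\<^bsub>K\<^esub> k)"
      if "r \<in> carrier R" "a \<in> carrier A" "k \<in> carrier K" for r a k
      using that t ring_hom_closed [OF u1_hom] ring_hom_closed [OF \<beta>]
      by (simp add: u1_smult struct_K smult_K ring_hom_mult [OF \<beta>] C.m_ac)
  qed (use \<phi>_hom \<Phi>K_hom C \<Phi>\<^sub>C u1_hom u\<^sub>1(2) in simp_all)
qed

end
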